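(* For every $\gamma\in(0,1]$: (i) $R_\gamma(\mathcal E_{\rm LS}) = \min\{\gamma, 1/2\}$ if $\gamma\ne 1$, and $R_1(\mathcal E_{\rm LS})=1$; (ii) $R_\gamma(\mathcal E_{\rm LU})=\gamma$; (iii) $\mathcal E_{\rm LD>0}\subseteq\mathcal E_{\rm D>1}$ and $$\frac{\gamma}{e-\gamma}\le R_\gamma(\mathcal E_{\rm LD>0})=\frac{\gamma}{t_\gamma},$$ where $t_\gamma$ is the unique solution $t\in[1,e)$ of $t(1-\log t)=\gamma$; moreover, $t_\gamma\uparrow e$ and $R_\gamma(\mathcal E_{\rm LD>0})/\gamma\downarrow 1/e$ as $\gamma\downarrow 0$; (iv) $R_\gamma(\mathcal E_{\rm LD})=R_\gamma(\mathcal E_{\rm LUS})$ and $$\frac{\gamma}{e}\le R_\gamma(\mathcal E_{\rm LD})=R_\gamma(\mathcal E_{\rm LUS})\le \min\left\{\frac{\gamma}{e(1-\gamma^2)},\ \frac{\gamma}{1+\sqrt{1-\gamma^2}}\right\}$$ (where the first term in the minimum is read as $+\infty$ when $\gamma=1$); (v) if $\gamma\neq 1$, then $$R_\gamma(\mathcal E_{\rm LN})=\Phi\left(-\sqrt{-2\log\gamma}\right)\le\frac{\gamma}{2\sqrt{-\pi\log\gamma}},$$ where $\Phi$ is the standard normal cumulative distribution function, and $R_1(\mathcal E_{\rm LN})=1$.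
   Context: Fix an atomless probability space with probability measure $\mathbb P$ and expectation $\mathbb E$ (so that every distribution on $[0,\infty)$ is the law of some random variable). An e-variable is a $[0,\infty]$-valued random variable $E$ with $\mathbb E[E]\le 1$; $\mathcal E_0$ is the set of all e-variables. For a nonempty set $\mathcal E\subseteq\mathcal E_0$ and $\gamma>0$, $R_\gamma(\mathcal E)=\sup_{E\in\mathcal E}\mathbb P(E\ge 1/\gamma)$. "Increasing" and "decreasing" are in the non-strict sense. A random variable $X$ has a symmetric distribution if there is $c\in\mathbb R$ such that $X$ and $c-X$ have the same law. In all the following sets except $\mathcal E_{\rm D>1}$, $\mathbb P(E=0)=0$ is required, so that $\log E$ is real-valued (a.s.). Point masses as described below are allowed as limiting cases of densities. - $\mathcal E_{\rm LS}$: $E\in\mathcal E_0$ such that $\log E$ has a symmetric distribution. - $\mathcal E_{\rm LU}$: $E\in\mathcal E_0$ such that $\log E$ has a unimodal density, i.e., for some $x\in\mathbb R$ the law of $\log E$ is the sum of a (possibly zero) point mass at $x$ and a part with density increasing on $(-\infty,x)$ and decreasing on $(x,\infty)$. - $\mathcal E_{\rm LD>0}$: $E\in\mathcal E_0$ such that $\log E$ has a decreasing density over $[0,\infty)$, i.e., the law of $\log E$ restricted to $[0,\infty)$ is the sum of a (possibly zero) point mass at $0$ and a part with density decreasing on $(0,\infty)$; the law of $\log E$ on $(-\infty,0)$ is arbitrary. - $\mathcal E_{\rm LD}$: $E\in\mathcal E_0$ such that $\log E$ has a decreasing density on its support, i.e., for the left endpoint $a\in\mathbb R$ of the support of $\log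 E$, the law of $\log E$ is the sum of a (possibly zero) point mass at $a$ and a part with density decreasing on $(a,\infty)$. - $\mathcal E_{\rm LUS}$: $E\in\mathcal E_0$ such that $\log E$ has a distribution that is both unimodal (in the sense above) and symmetric. - $\mathcal E_{\rm LN}$: $E\in\mathcal E_0$ having a log-normal distribution, i.e., $\log E$ is normal, including degenerate (zero variance) normal distributions. - $\mathcal E_{\rm D>1}$: $E\in\mathcal E_0$ such that the law of $E$ restricted to $[1,\infty)$ is the sum of a (possibly zero) point mass at $1$ and a part with density decreasing on $(1,\infty)$; the law on $[0,1)$ is arbitrary. *)

theory Defs
  imports "HOL-Probability.Probability"
begin

definition atomless :: "'a measure \<Rightarrow> bool" where
  "atomless M \<longleftrightarrow>
     (\<forall>A\<in>sets M. 0 < emeasure M A \<longrightarrow>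
        (\<exists>B\<in>sets M. B \<subseteq> A \<and> 0 < emeasure M B \<and> emeasure M B < emeasure M A))"

definition e_variables :: "'a measure \<Rightarrow> ('a \<Rightarrow> ennreal) set" where
  "e_variables M = {E \<in> borel_measurable M. (\<integral>\<^sup>+ \<omega>. E \<omega> \<partial>M) \<le> 1}"

text \<open>The supremum is taken in the reals, so it is meaningful only for nonempty sets
  of e-variables.\<close>

definition R :: "'a measure \<Rightarrow> real \<Rightarrow> ('a \<Rightarrow> ennreal) set \<Rightarrow> real" where
  "R M \<gamma> S = (SUP E\<in>S. measure M {\<omega> \<in> space M. ennreal (1 / \<gamma>) \<le> E \<omega>})"

text \<open>An e-variable is almost surely finite. The values \<open>enn2real \<infinity> = 0\<close> and
  \<open>ln 0 = 0\<close> therefore only matter on a null set whenever, in addition,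
  \<open>E > 0\<close> almost surely; \<open>log_law\<close> is used only under that assumption.\<close>

definition law :: "'a measure \<Rightarrow> ('a \<Rightarrow> ennreal) \<Rightarrow> real measure" where
  "law M E = distr M borel (\<lambda>\<omega>. enn2real (E \<omega>))"

definition log_law :: "'a measure \<Rightarrow> ('a \<Rightarrow> ennreal) \<Rightarrow> real measure" where
  "log_law M E = distr M borel (\<lambda>\<omega>. ln (enn2real (E \<omega>)))"

definition pos_e_variables :: "'a measure \<Rightarrow> ('a \<Rightarrow> ennreal) set" where
  "pos_e_variables M = {E \<in> e_variables M. measure M {\<omega> \<in> space M. E \<omega> = 0} = 0}"

text \<open>On the Borel subsets of \<open>S\<close>, \<open>\<mu>\<close> is a point mass of weight
  \<open>p\<close> at \<open>x\<close> plus a part with Lebesgue density \<open>f\<close>.\<close>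

definition atom_plus_density ::
    "real set \<Rightarrow> real \<Rightarrow> real \<Rightarrow> (real \<Rightarrow> real) \<Rightarrow> real measure \<Rightarrow> bool" where
  "atom_plus_density S x p f \<mu> \<longleftrightarrow>
     0 \<le> p \<and> f \<in> borel_measurable borel \<and> (\<forall>y. 0 \<le> f y) \<and>
     (\<forall>A\<in>sets borel. A \<subseteq> S \<longrightarrow>
        emeasure \<mu> A = ennreal p * indicator A x + emeasure (density lborel (\<lambda>y. ennreal (f y))) A)"

definition symmetric_law :: "real measure \<Rightarrow> bool" where
  "symmetric_law \<mu> \<longleftrightarrow> (\<exists>c. distr \<mu> borel (\<lambda>y. c - y) = \<mu>)"

definition unimodal_law :: "real measure \<Rightarrow> bool" where
  "unimodal_law \<mu> \<longleftrightarrow>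
     (\<exists>x p f. atom_plus_density UNIV x p f \<mu> \<and> mono_on {..<x} f \<and> antimono_on {x<..} f)"

definition decreasing_law_from :: "real \<Rightarrow> real measure \<Rightarrow> bool" where
  "decreasing_law_from b \<mu> \<longleftrightarrow>
     (\<exists>p f. atom_plus_density {b..} b p f \<mu> \<and> antimono_on {b<..} f)"

definition law_support :: "real measure \<Rightarrow> real set" where
  "law_support \<mu> = {y. \<forall>U. open U \<and> y \<in> U \<longrightarrow> 0 < emeasure \<mu> U}"

text \<open>Since \<open>a\<close> is the left endpoint of the support, \<open>f\<close> vanishes almost
  everywhere on \<open>(-\<infinity>, a)\<close>.\<close>

definition decreasing_law_on_support :: "real measure \<Rightarrow> bool" where
  "decreasing_law_on_support \<mu> \<longleftrightarrow>
     (\<exists>a p f. bdd_below (law_support \<mu>) \<and> a = Inf (law_support \<mu>) \<and>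
        atom_plus_density UNIV a p f \<mu> \<and> antimono_on {a<..} f)"

definition normal_law :: "real measure \<Rightarrow> bool" where
  "normal_law \<mu> \<longleftrightarrow>
     (\<exists>m. \<mu> = return borel m \<or>
        (\<exists>\<sigma>>0. \<mu> = density lborel (\<lambda>y. ennreal (normal_density m \<sigma> y))))"

definition E_LS :: "'a measure \<Rightarrow> ('a \<Rightarrow> ennreal) set" where
  "E_LS M = {E \<in> pos_e_variables M. symmetric_law (log_law M E)}"

definition E_LU :: "'a measure \<Rightarrow> ('a \<Rightarrow> ennreal) set" where
  "E_LU M = {E \<in> pos_e_variables M. unimodal_law (log_law M E)}"

definition E_LD_pos :: "'a measure \<Rightarrow> ('a \<Rightarrow> ennreal) set" where
  "E_LD_pos M = {E \<in> pos_e_variables M. decreasing_law_from 0 (log_law M E)}"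

definition E_LD :: "'a measure \<Rightarrow> ('a \<Rightarrow> ennreal) set" where
  "E_LD M = {E \<in> pos_e_variables M. decreasing_law_on_support (log_law M E)}"

definition E_LUS :: "'a measure \<Rightarrow> ('a \<Rightarrow> ennreal) set" where
  "E_LUS M = {E \<in> pos_e_variables M. unimodal_law (log_law M E) \<and> symmetric_law (log_law M E)}"

definition E_LN :: "'a measure \<Rightarrow> ('a \<Rightarrow> ennreal) set" where
  "E_LN M = {E \<in> pos_e_variables M. normal_law (log_law M E)}"

definition E_D_gt1 :: "'a measure \<Rightarrow> ('a \<Rightarrow> ennreal) set" where
  "E_D_gt1 M = {E \<in> e_variables M. decreasing_law_from 1 (law M E)}"

definition is_t :: "real \<Rightarrow> real \<Rightarrow> bool" where
  "is_t \<gamma> t \<longleftrightarrow> 1 \<le> t \<and> t < exp 1 \<and> t * (1 - ln t) = \<gamma>"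

definition t_sol :: "real \<Rightarrow> real" where
  "t_sol \<gamma> = (THE t. is_t \<gamma> t)"

end

theory Submission
  imports Defs
begin

text \<open>
  All classes except D>1 are described by the law \<open>\<mu>\<close> of \<open>log E\<close>. Since the space
  is atomless, every law on the line is the law of some random variable, so with
  \<open>L = - ln \<gamma>\<close> the number \<open>R\<^sub>\<gamma>\<close> is the supremum of \<open>\<mu> [L, \<infinity>)\<close> over the laws
  \<open>\<mu>\<close> of the given shape with \<open>\<integral> e\<^sup>x d\<mu> \<le> 1\<close>. The random variables come from a chain of
  events that contains one event of each probability (\<open>saturated_chain_hits\<close>), and
  the reduction is \<open>R_eq_tail_sup\<close>. It remains to solve a moment problem for each shape.
  For \<open>L = 0\<close> the constant \<open>1\<close> is extremal in every class; suppose \<open>L > 0\<close> from here on.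

  \<^item> Markov's inequality gives \<open>\<mu> [L, \<infinity>) \<le> e\<^sup>-\<^sup>L = \<gamma>\<close>. In the class LU it is sharp because an atom at
    \<open>L\<close> can be completed by a very long uniform piece on its left, whose exponential moment is
    negligible. In LS the centre of symmetry must be nonpositive, by convexity of \<open>exp\<close>, which adds
    the bound \<open>1/2\<close>; three atoms, two of which are far to the left, approach the minimum.

  \<^item> For decreasing densities the key is \<open>flatten_density\<close>: replace the density \<open>f\<close>
    beyond a point \<open>a < L\<close> by the constant \<open>f L\<close> on \<open>[a, b]\<close>, with \<open>b\<close> chosen so that the tail
    mass beyond \<open>L\<close> is kept. Below \<open>L\<close> this removes mass, and beyond \<open>L\<close> it moves mass
    towards \<open>L\<close>, so the integral over \<open>(a, \<infinity>)\<close> of a nonnegative increasing function does not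
    grow. In the class LD>0 this leaves an elementary inequality in \<open>b\<close>, with equality at \<open>b = - ln (1 - ln t\<^sub>\<gamma>)\<close>.

  \<^item> In LD and LUS one flattens as well and then spreads the remaining mass uniformly to the left. In both
    cases the outcome is a uniform law with the same tail and an exponential moment at most \<open>1\<close>.
    Uniform laws belong to both classes, so both suprema equal the supremum over uniform laws,
    and the stated bounds are inequalities for uniform laws on an interval.

  \<^item> In LN the constraint reads \<open>m + \<sigma>\<^sup>2/2 \<le> 0\<close>, and the inequality of arithmetic and geometric means
    yields the best variance \<open>\<sigma>\<^sup>2 = 2 L\<close>. The explicit bound is the Mills ratio estimate.

  The inclusion of LD>0 in D>1 is the change of variables \<open>y = e\<^sup>x\<close>, which turns a density \<open>f x\<close>
  into \<open>f (ln y) / y\<close> and so preserves monotonicity.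
\<close>

section \<open>Random variables with a prescribed law on an atomless space\<close>

text \<open>
  A maximal chain of events for the order "contained in, and of strictly smaller probability".
  Strictness makes the probability injective on a chain; under plain inclusion, two
  different members could have the same probability.
\<close>
definition saturated_chain :: "'a measure \<Rightarrow> 'a set set \<Rightarrow> bool" where
  "saturated_chain M C \<longleftrightarrow> C \<subseteq> sets M \<and>
     (\<forall>A\<in>C. \<forall>B\<in>C. A = B \<or> A \<subseteq> B \<and> measure M A < measure M B \<or> B \<subseteq> A \<and> measure M B < measure M A) \<and>
     (\<forall>E\<in>sets M. (\<forall>A\<in>C. A = E \<or> A \<subseteq> E \<and> measure M A < measure M E
                              \<or> E \<subseteq> A \<and> measure M E < measure M A) \<longrightarrow> E \<in> C)"

lemma saturated_chain_exists: "\<exists>C. saturated_chain M C"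
proof -
  let ?lt = "\<lambda>A B. A \<subseteq> B \<and> measure M A < measure M B"
  obtain C where C: "pred_on.maxchain (sets M) ?lt C"
    using pred_on.Hausdorff[of "sets M" ?lt] by blast
  have chain: "pred_on.chain (sets M) ?lt C" using C by (simp add: pred_on.maxchain_def)
  have "E \<in> C" if E: "E \<in> sets M"
    and cmp: "\<forall>A\<in>C. A = E \<or> A \<subseteq> E \<and> measure M A < measure M E \<or> E \<subseteq> A \<and> measure M E < measure M A" for E
  proof (rule ccontr)
    assume "E \<notin> C"
    moreover have "pred_on.chain (sets M) ?lt (insert E C)"
      unfolding pred_on.chain_def
    proof (intro conjI ballI)
      show "insert E C \<subseteq> sets M" using chain E unfolding pred_on.chain_def by blast
      fix A B assume "A \<in> insert E C" "B \<in> insert E C"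
      then show "(sup ?lt (=)) A B \<or> (sup ?lt (=)) B A"
        using chain cmp unfolding pred_on.chain_def by (elim insertE) auto
    qed
    ultimately show False using C unfolding pred_on.maxchain_def by blast
  qed
  moreover have "A = B \<or> A \<subseteq> B \<and> measure M A < measure M B \<or> B \<subseteq> A \<and> measure M B < measure M A"
    if "A \<in> C" "B \<in> C" for A B
    using pred_on.chain_total[OF chain that] by auto
  moreover have "C \<subseteq> sets M" using chain unfolding pred_on.chain_def by (elim conjE)
  ultimately have "saturated_chain M C"
    unfolding saturated_chain_def by (intro conjI ballI impI)
  then show ?thesis by (rule exI)
qed

lemma saturated_chain_total:
  assumes "saturated_chain M C" "A \<in> C" "B \<in> C"
  shows "A = B \<or> A \<subseteq> B \<and> measure M A < measure M B \<or> B \<subseteq> A \<and> measure M B < measure M A"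
  using assms unfolding saturated_chain_def by (elim conjE) (rule bspec, erule bspec)

lemma saturated_chain_max:
  assumes "saturated_chain M C" "E \<in> sets M"
    "\<And>A. A \<in> C \<Longrightarrow> A = E \<or> A \<subseteq> E \<and> measure M A < measure M E
                              \<or> E \<subseteq> A \<and> measure M E < measure M A"
  shows "E \<in> C"
proof -
  have "(\<forall>A\<in>C. A = E \<or> A \<subseteq> E \<and> measure M A < measure M E
                              \<or> E \<subseteq> A \<and> measure M E < measure M A) \<longrightarrow> E \<in> C"
    using assms(1,2) unfolding saturated_chain_def by (elim conjE) (erule bspec)
  then show ?thesis using assms(3) by (rule mp[OF _ ballI])
qed

text \<open>Passing to complements exchanges approximation from below and from above, so that
  only the former has to be proved.\<close>
lemma saturated_chain_compl:
  assumes "prob_space M" "saturated_chain M C"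
  shows "saturated_chain M ((\<lambda>A. space M - A) ` C)"
proof -
  interpret prob_space M by fact
  have C: "C \<subseteq> sets M" using assms(2) by (simp add: saturated_chain_def)
  have sub: "A \<subseteq> space M" if "A \<in> C" for A using C that sets.sets_into_space by blast
  have 1: "(\<lambda>A. space M - A) ` C \<subseteq> sets M" using C by auto
  have 2: "\<forall>A\<in>(\<lambda>A. space M - A) ` C. \<forall>B\<in>(\<lambda>A. space M - A) ` C. A = B \<or> A \<subseteq> B \<and> prob A < prob B \<or> B \<subseteq> A \<and> prob B < prob A"
  proof (clarify, goal_cases)
    case (1 _ A _ B)
    have "A \<in> events" "B \<in> events" using 1 C by auto
    moreover have "A = B \<or> A \<subseteq> B \<and> prob A < prob B \<or> B \<subseteq> A \<and> prob B < prob A"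
      using saturated_chain_total[OF assms(2)] 1 by simp
    ultimately show ?case using 1 by (auto simp: prob_compl)
  qed
  have 3: "E \<in> (\<lambda>A. space M - A) ` C" if E: "E \<in> sets M"
    and cmp: "\<forall>A\<in>(\<lambda>A. space M - A) ` C. A = E \<or> A \<subseteq> E \<and> measure M A < measure M E
                              \<or> E \<subseteq> A \<and> measure M E < measure M A" for E
  proof -
    have Es: "E \<subseteq> space M" using E sets.sets_into_space by blast
    have "space M - E \<in> C"
    proof -
      have "\<forall>A\<in>C. A = space M - E \<or> A \<subseteq> space M - E \<and> prob A < prob (space M - E)
          \<or> space M - E \<subseteq> A \<and> prob (space M - E) < prob A"
      proof
        fix A assume A: "A \<in> C"
        then have Ae: "A \<in> events" using C by auto
        have "space M - A = E \<or> space M - A \<subseteq> E \<and> prob (space M - A) < prob E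
                              \<or> E \<subseteq> space M - A \<and> prob E < prob (space M - A)"
          using A by (intro cmp[rule_format]) (rule imageI)
        moreover have "space M - A = E \<longleftrightarrow> A = space M - E"
          using double_diff[OF sub[OF A] order_refl] double_diff[OF Es order_refl] by metis
        moreover have "space M - A \<subseteq> E \<longleftrightarrow> space M - E \<subseteq> A" by auto
        moreover have "E \<subseteq> space M - A \<longleftrightarrow> A \<subseteq> space M - E"
          using Es sub[OF A] by auto
        moreover have "prob (space M - A) = 1 - prob A" "prob (space M - E) = 1 - prob E"
          using Ae E by (simp_all add: prob_compl)
        ultimately show "A = space M - E \<or> A \<subseteq> space M - E \<and> prob A < prob (space M - E)
          \<or> space M - E \<subseteq> A \<and> prob (space M - E) < prob A"
          by argo
      qed
      moreover have "space M - E \<in> sets M" using E by auto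
      ultimately show ?thesis by (intro saturated_chain_max[OF assms(2)]) auto
    qed
    then show ?thesis using Es by (intro image_eqI[of _ _ "space M - E"]) auto
  qed
  show ?thesis unfolding saturated_chain_def
    by (rule conjI[OF 1 conjI[OF 2]], intro ballI impI, rule 3)
qed

text \<open>
  The supremum of the probabilities not exceeding \<open>t\<close> is attained: otherwise it is approached along an
  increasing sequence of members, whose union is comparable with every member
  and hence, by maximality, is a member itself.
\<close>
lemma saturated_chain_last_below:
  assumes "prob_space M" "saturated_chain M C" "0 \<le> t"
  shows "\<exists>A\<in>C. measure M A \<le> t \<and> (\<forall>B\<in>C. measure M B \<le> t \<longrightarrow> measure M B \<le> measure M A)"
proof -
  interpret prob_space M by fact
  have C: "C \<subseteq> sets M" using assms(2) by (simp add: saturated_chain_def)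
  have cmp: "A = B \<or> A \<subseteq> B \<and> prob A < prob B \<or> B \<subseteq> A \<and> prob B < prob A" if "A \<in> C" "B \<in> C" for A B
    using saturated_chain_total[OF assms(2) that] .
  have le: "A \<subseteq> B" if "A \<in> C" "B \<in> C" "prob A < prob B" for A B
    using cmp[OF that(1,2)] that(3) by auto
  have sat: "E \<in> C" if "E \<in> events"
    "\<And>A. A \<in> C \<Longrightarrow> A = E \<or> A \<subseteq> E \<and> prob A < prob E \<or> E \<subseteq> A \<and> prob E < prob A" for E
    using saturated_chain_max[OF assms(2) that] .
  define Lo where "Lo = {A\<in>C. prob A \<le> t}"
  \<comment> \<open>If every member had probability above \<open>t \<ge> 0\<close>, the chain could be extended by the empty set.\<close>
  have ne: "Lo \<noteq> {}"
  proof
    assume "Lo = {}"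
    then have "prob A > 0" if "A \<in> C" for A using that assms(3) unfolding Lo_def by force
    then have "{} \<in> C" by (intro sat) auto
    then show False using \<open>Lo = {}\<close> assms(3) unfolding Lo_def by auto
  qed
  define s where "s = (SUP A\<in>Lo. prob A)"
  have bdd: "bdd_above (prob ` Lo)" by (rule bdd_aboveI[of _ 1]) auto
  have up: "prob A \<le> s" if "A \<in> Lo" for A unfolding s_def using that bdd by (rule cSUP_upper)
  have st: "s \<le> t" unfolding s_def using ne by (intro cSUP_least) (auto simp: Lo_def)
  show ?thesis
  proof (cases "\<exists>A\<in>Lo. prob A = s")
    case True
    then obtain A where "A \<in> Lo" "prob A = s" by blast
    then show ?thesis using up unfolding Lo_def by auto
  next
    case False
    then have lt: "prob A < s" if "A \<in> Lo" for A using up[OF that] that by force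
    have app: "\<exists>A\<in>Lo. y < prob A" if "y < s" for y
      using that less_cSUP_iff[OF ne bdd] unfolding s_def by blast
    have "\<exists>D. \<forall>n::nat. (D n \<in> Lo \<and> s - 1 / Suc n < prob (D n)) \<and> D n \<subseteq> D (Suc n)"
    proof (rule dependent_nat_choice)
      show "\<exists>x. x \<in> Lo \<and> s - 1 / real (Suc 0) < prob x" using app[of "s - 1"] by auto
    next
      fix A n assume A: "A \<in> Lo \<and> s - 1 / real (Suc n) < prob A"
      obtain B where B: "B \<in> Lo" "max (prob A) (s - 1 / real (Suc (Suc n))) < prob B"
        using app[of "max (prob A) (s - 1 / real (Suc (Suc n)))"] lt A by auto
      then have "A \<subseteq> B" using A by (intro le) (auto simp: Lo_def)
      then show "\<exists>y. (y \<in> Lo \<and> s - 1 / real (Suc (Suc n)) < prob y) \<and> A \<subseteq> y" using B by auto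
    qed
    then obtain D where D: "\<And>n. D n \<in> Lo" "\<And>n::nat. s - 1 / Suc n < prob (D n)" "\<And>n. D n \<subseteq> D (Suc n)" by blast
    have inc: "incseq D" using D(3) by (intro incseq_SucI) auto
    define A where "A = (\<Union>n. D n)"
    have Aev: "A \<in> events" using D(1) C unfolding A_def Lo_def by blast
    have "(\<lambda>n. prob (D n)) \<longlonglongrightarrow> prob A" unfolding A_def
      using D(1) C inc by (intro finite_Lim_measure_incseq) (auto simp: Lo_def)
    moreover have "(\<lambda>n. prob (D n)) \<longlonglongrightarrow> s"
    proof (rule tendsto_sandwich)
      show "(\<lambda>n. s - 1 / real (Suc n)) \<longlonglongrightarrow> s"
        using tendsto_diff[OF tendsto_const[of s] LIMSEQ_inverse_real_of_nat]
        by (simp add: inverse_eq_divide)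
      show "(\<lambda>n. s) \<longlonglongrightarrow> s" by simp
      show "\<forall>\<^sub>F n in sequentially. s - 1 / real (Suc n) \<le> prob (D n)" using D(2) by (intro always_eventually allI less_imp_le)
      show "\<forall>\<^sub>F n in sequentially. prob (D n) \<le> s" using up D(1) by auto
    qed
    ultimately have pA: "prob A = s" using LIMSEQ_unique by blast
    have "A \<in> C"
    proof (rule sat[OF Aev])
      fix B assume B: "B \<in> C"
      show "B = A \<or> B \<subseteq> A \<and> prob B < prob A \<or> A \<subseteq> B \<and> prob A < prob B"
      proof (cases "B \<in> Lo")
        case True
        obtain n where "prob B < s - 1 / Suc n"
        proof -
          have "0 < s - prob B" using lt[OF True] by auto
          from reals_Archimedean[OF this] that show ?thesis by (auto simp: inverse_eq_divide algebra_simps)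
        qed
        then have "B \<subseteq> D n" using le[of B "D n"] B D(1,2)[of n] by (force simp: Lo_def)
        then show ?thesis using lt[OF True] pA by (auto simp: A_def)
      next
        case False
        then have t: "t < prob B" using B by (auto simp: Lo_def)
        have "D n \<subseteq> B" for n using le[of "D n" B] B D(1)[of n] t by (auto simp: Lo_def)
        then show ?thesis using pA st t by (auto simp: A_def)
      qed
    qed
    then have "A \<in> Lo" using st pA by (auto simp: Lo_def)
    then show ?thesis using False pA by auto
  qed
qed

text \<open>If \<open>t\<close> were skipped, there would be a last member below and a first member above \<open>t\<close>. An
  atomless space has an event of intermediate probability between these two, which contradicts maximality.\<close>
lemma saturated_chain_hits:
  assumes "prob_space M" "atomless M" "saturated_chain M C" "0 \<le> t" "t \<le> 1"
  shows "\<exists>A\<in>C. measure M A = t"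
proof (rule ccontr)
  assume no: "\<not> ?thesis"
  interpret prob_space M by fact
  have C: "C \<subseteq> sets M" using assms(3) by (simp add: saturated_chain_def)
  have cmp: "A = B \<or> A \<subseteq> B \<and> prob A < prob B \<or> B \<subseteq> A \<and> prob B < prob A" if "A \<in> C" "B \<in> C" for A B
    using saturated_chain_total[OF assms(3) that] .
  obtain A where A: "A \<in> C" "prob A \<le> t" "\<And>B. B \<in> C \<Longrightarrow> prob B \<le> t \<Longrightarrow> prob B \<le> prob A"
    using saturated_chain_last_below[OF assms(1,3,4)] by blast
  obtain B' where B': "B' \<in> C" "prob (space M - B') \<le> 1 - t"
      "\<And>B. B \<in> C \<Longrightarrow> prob (space M - B) \<le> 1 - t \<Longrightarrow> prob (space M - B) \<le> prob (space M - B')"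
    using saturated_chain_last_below[OF assms(1) saturated_chain_compl[OF assms(1,3)], of "1 - t"] assms(5)
    by auto
  have B: "t \<le> prob B'" "\<And>B. B \<in> C \<Longrightarrow> t \<le> prob B \<Longrightarrow> prob B' \<le> prob B"
  proof -
    show "t \<le> prob B'" using B'(1,2) C prob_compl[of B'] by auto
    fix B assume "B \<in> C" "t \<le> prob B"
    then show "prob B' \<le> prob B" using B'(1) B'(3)[of B] C prob_compl[of B'] prob_compl[of B] by force
  qed
  have strict: "prob A < t" "t < prob B'" using A B B'(1) no by force+
  have AB: "A \<subseteq> B'" using cmp[OF A(1) B'(1)] strict by auto
  have ev: "A \<in> events" "B' \<in> events" using A(1) B'(1) C by auto
  have "prob (B' - A) = prob B' - prob A" using AB ev by (intro finite_measure_Diff) auto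
  then have "0 < emeasure M (B' - A)" using strict by (simp add: emeasure_eq_measure)
  moreover have "B' - A \<in> events" using ev by auto
  ultimately obtain D where D: "D \<in> events" "D \<subseteq> B' - A" "0 < prob D" "prob D < prob (B' - A)"
    using assms(2) unfolding atomless_def by (auto simp: emeasure_eq_measure ennreal_less_iff)
  define E where "E = A \<union> D"
  have pE: "prob E = prob A + prob D" unfolding E_def using D ev by (intro finite_measure_Union) auto
  have Eb: "prob A < prob E" "prob E < prob B'"
    using D pE \<open>prob (B' - A) = prob B' - prob A\<close> by auto
  have sub: "A \<subseteq> E" "E \<subseteq> B'" using D AB by (auto simp: E_def)
  have "E \<in> C"
  proof -
    have "\<forall>F\<in>C. F = E \<or> F \<subseteq> E \<and> prob F < prob E \<or> E \<subseteq> F \<and> prob E < prob F"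
    proof
      fix F assume F: "F \<in> C"
      show "F = E \<or> F \<subseteq> E \<and> prob F < prob E \<or> E \<subseteq> F \<and> prob E < prob F"
      proof (cases "prob F \<le> t")
        case True
        then have "prob F \<le> prob A" using A(3) F by blast
        then show ?thesis using cmp[OF F A(1)] sub Eb by auto
      next
        case False
        then have "prob B' \<le> prob F" using B(2) F by auto
        then show ?thesis using cmp[OF F B'(1)] sub Eb by auto
      qed
    qed
    moreover have "E \<in> events" using D ev by (auto simp: E_def)
    ultimately show ?thesis by (intro saturated_chain_max[OF assms(3)]) simp_all
  qed
  then show False using A(3)[of E] B(2)[of E] Eb by linarith
qed

lemma atomless_nested_sets:
  assumes "prob_space M" "atomless M"
  obtains S :: "real \<Rightarrow> 'a set" where
    "\<And>t. t \<in> {0..1} \<Longrightarrow> S t \<in> sets M" "\<And>t. t \<in> {0..1} \<Longrightarrow> measure M (S t) = t"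
    "\<And>s t. s \<in> {0..1} \<Longrightarrow> t \<in> {0..1} \<Longrightarrow> s \<le> t \<Longrightarrow> S s \<subseteq> S t"
proof -
  obtain C where C: "saturated_chain M C" using saturated_chain_exists by blast
  have "\<forall>t\<in>{0..1}. \<exists>A\<in>C. measure M A = t"
    using saturated_chain_hits[OF assms C] by auto
  then obtain S where S: "\<And>t. t \<in> {0..1} \<Longrightarrow> S t \<in> C" "\<And>t. t \<in> {0..1} \<Longrightarrow> measure M (S t) = t"
    by metis
  show ?thesis
  proof (rule that)
    show "S t \<in> sets M" if "t \<in> {0..1}" for t using S(1)[OF that] C unfolding saturated_chain_def by blast
    show "measure M (S t) = t" if "t \<in> {0..1}" for t using S(2)[OF that] .
    show "S s \<subseteq> S t" if "s \<in> {0..1}" "t \<in> {0..1}" "s \<le> t" for s t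
    proof -
      have "S s = S t \<or> S s \<subseteq> S t \<and> measure M (S s) < measure M (S t) \<or> S t \<subseteq> S s \<and> measure M (S t) < measure M (S s)"
        by (rule saturated_chain_total[OF C S(1)[OF that(1)] S(1)[OF that(2)]])
      then show ?thesis using S(2)[OF that(1)] S(2)[OF that(2)] that(3) by auto
    qed
  qed
qed

text \<open>If the events \<open>S t\<close> increase with \<open>t\<close> and have probability \<open>t\<close>, then the first time \<open>t\<close> at which
  \<open>\<omega>\<close> lies in \<open>S t\<close> is uniformly distributed.\<close>
lemma atomless_uniform_variable:
  assumes "prob_space M" "atomless M"
  obtains U :: "'a \<Rightarrow> real" where "U \<in> borel_measurable M"
    "\<And>x. x \<in> {0..1} \<Longrightarrow> measure M {\<omega>\<in>space M. U \<omega> \<le> x} = x"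
    "AE \<omega> in M. 0 < U \<omega> \<and> U \<omega> < 1"
proof -
  interpret prob_space M by fact
  obtain S where S: "\<And>t. t \<in> {0..1} \<Longrightarrow> S t \<in> sets M" "\<And>t. t \<in> {0..1} \<Longrightarrow> measure M (S t) = t"
    "\<And>s t. s \<in> {0..1} \<Longrightarrow> t \<in> {0..1} \<Longrightarrow> s \<le> t \<Longrightarrow> S s \<subseteq> S t"
    using atomless_nested_sets[OF assms] by metis
  define T where "T \<omega> = insert 1 {t\<in>{0..1}. \<omega> \<in> S t}" for \<omega>
  define U where "U \<omega> = Inf (T \<omega>)" for \<omega>
  have T01: "t \<in> {0..1}" if "t \<in> T \<omega>" for t \<omega> using that unfolding T_def by auto
  have Tne: "T \<omega> \<noteq> {}" "bdd_below (T \<omega>)" for \<omega>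
    using T01 by (auto simp: T_def intro!: bdd_belowI[of _ 0])
  have U01: "0 \<le> U \<omega>" "U \<omega> \<le> 1" for \<omega>
  proof -
    show "0 \<le> U \<omega>" unfolding U_def using Tne T01 by (intro cInf_greatest) auto
    show "U \<omega> \<le> 1" unfolding U_def using Tne by (intro cInf_lower) (auto simp: T_def)
  qed
  have less: "U \<omega> < x \<longleftrightarrow> (\<exists>t\<in>{0..1}. t < x \<and> \<omega> \<in> S t)" if "x \<le> 1" for \<omega> x
    unfolding U_def using cInf_less_iff[OF Tne] that by (auto simp: T_def)
  have Ulow: "\<omega> \<in> S t \<Longrightarrow> U \<omega> \<le> t" if "t \<in> {0..1}" for t \<omega>
    unfolding U_def using Tne that by (intro cInf_lower) (auto simp: T_def)
  have meas: "U \<in> borel_measurable M"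
  proof (rule borel_measurableI_less)
    fix x :: real
    consider "x > 1" | "x \<le> 0" | "0 < x" "x \<le> 1" by linarith
    then show "{\<omega> \<in> space M. U \<omega> < x} \<in> sets M"
    proof cases
      case 1
      then have "{\<omega> \<in> space M. U \<omega> < x} = space M" using U01 by (auto intro: le_less_trans)
      then show ?thesis by simp
    next
      case 2
      then have "{\<omega> \<in> space M. U \<omega> < x} = {}" using U01 by (auto simp: not_less intro: order_trans)
      then show ?thesis by (simp only: sets.empty_sets)
    next
      case 3
      have "{\<omega> \<in> space M. U \<omega> < x} = (\<Union>t\<in>\<rat> \<inter> {0..<x}. S t)"
      proof (intro set_eqI iffI)
        fix \<omega> assume "\<omega> \<in> {\<omega> \<in> space M. U \<omega> < x}"
        then obtain t where t: "t \<in> {0..1}" "t < x" "\<omega> \<in> S t" using less 3 by auto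
        obtain r where r: "r \<in> \<rat>" "t < r" "r < x" using Rats_dense_in_real[OF t(2)] by blast
        then have "S t \<subseteq> S r" using S(3)[of t r] t 3 by auto
        then show "\<omega> \<in> (\<Union>t\<in>\<rat> \<inter> {0..<x}. S t)" using t r by auto
      next
        fix \<omega> assume "\<omega> \<in> (\<Union>t\<in>\<rat> \<inter> {0..<x}. S t)"
        then obtain t where t: "0 \<le> t" "t < x" "\<omega> \<in> S t" by auto
        then have "\<omega> \<in> space M" using S(1)[of t] 3 sets.sets_into_space by fastforce
        then show "\<omega> \<in> {\<omega> \<in> space M. U \<omega> < x}" using less[of x \<omega>] t 3 by force
      qed
      also have "\<dots> \<in> sets M"
        using 3 S(1) by (intro sets.countable_UN' countable_Int1 countable_rat) auto
      finally show ?thesis .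
    qed
  qed
  note [measurable] = meas
  have cdf: "prob {\<omega>\<in>space M. U \<omega> \<le> x} = x" if x: "x \<in> {0..1}" for x
  proof (cases "x = 1")
    case True
    then have "{\<omega>\<in>space M. U \<omega> \<le> x} = space M" using U01 by auto
    then show ?thesis using True by (simp add: prob_space)
  next
    case False
    have "prob (S x) \<le> prob {\<omega>\<in>space M. U \<omega> \<le> x}"
      using Ulow[OF x] sets.sets_into_space[OF S(1)[OF x]] by (intro finite_measure_mono) auto
    then have "x \<le> prob {\<omega>\<in>space M. U \<omega> \<le> x}" using S(2)[OF x] by simp
    moreover have "prob {\<omega>\<in>space M. U \<omega> \<le> x} \<le> x"
    proof (rule field_le_epsilon)
      fix e :: real assume e: "0 < e"
      define y where "y = min 1 (x + e)"
      have y: "y \<in> {0..1}" "x < y" "y \<le> x + e" using x False e by (auto simp: y_def)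
      have "{\<omega>\<in>space M. U \<omega> \<le> x} \<subseteq> S y"
      proof
        fix \<omega> assume "\<omega> \<in> {\<omega>\<in>space M. U \<omega> \<le> x}"
        then obtain t where "t \<in> {0..1}" "t < y" "\<omega> \<in> S t" using less[of y \<omega>] y by force
        then show "\<omega> \<in> S y" using S(3)[of t y] y by auto
      qed
      then have "prob {\<omega>\<in>space M. U \<omega> \<le> x} \<le> prob (S y)"
        using S(1)[OF y(1)] by (rule finite_measure_mono)
      then show "prob {\<omega>\<in>space M. U \<omega> \<le> x} \<le> x + e"
        using S(2)[OF y(1)] y(3) by linarith
    qed
    ultimately show ?thesis by simp
  qed
  have "AE \<omega> in M. 0 < U \<omega>"
  proof -
    have "prob {\<omega>\<in>space M. U \<omega> \<le> 0} = 0" using cdf[of 0] by simp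
    then have "AE \<omega> in M. \<omega> \<notin> {\<omega>\<in>space M. U \<omega> \<le> 0}"
      by (subst prob_eq_0[symmetric]) auto
    then show ?thesis using AE_space by eventually_elim (auto simp: not_le)
  qed
  moreover have "AE \<omega> in M. U \<omega> < 1"
  proof -
    have "1 \<le> prob {\<omega>\<in>space M. U \<omega> < 1}"
    proof (rule field_le_epsilon)
      fix e :: real assume e: "0 < e"
      have "1 - min 1 e = prob {\<omega>\<in>space M. U \<omega> \<le> 1 - min 1 e}" using cdf[of "1 - min 1 e"] e by auto
      also have "\<dots> \<le> prob {\<omega>\<in>space M. U \<omega> < 1}" using e by (intro finite_measure_mono) auto
      finally show "1 \<le> prob {\<omega>\<in>space M. U \<omega> < 1} + e" by auto
    qed
    then have "prob {\<omega>\<in>space M. U \<omega> < 1} = 1" using prob_le_1[of "{\<omega>\<in>space M. U \<omega> < 1}"] by linarith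
    then show ?thesis by (subst (asm) prob_Collect_eq_1) auto
  qed
  ultimately have "AE \<omega> in M. 0 < U \<omega> \<and> U \<omega> < 1" by eventually_elim auto
  then show ?thesis using meas cdf by (intro that)
qed

text \<open>The quantile function of \<open>\<mu>\<close>, which is \<open>\<mu>.I\<close> below, maps a uniform variable to one with law \<open>\<mu>\<close>.\<close>
lemma atomless_has_every_law:
  fixes \<mu> :: "real measure"
  assumes "prob_space M" "atomless M" "real_distribution \<mu>"
  obtains X where "X \<in> borel_measurable M" "distr M borel X = \<mu>"
proof -
  interpret prob_space M by fact
  interpret \<mu>: cdf_distribution \<mu> using assms(3) by (simp add: cdf_distribution_def)
  obtain U where [measurable]: "U \<in> borel_measurable M"
    and U: "\<And>x. x \<in> {0..1} \<Longrightarrow> prob {\<omega>\<in>space M. U \<omega> \<le> x} = x"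
    and U01: "AE \<omega> in M. 0 < U \<omega> \<and> U \<omega> < 1"
    using atomless_uniform_variable[OF assms(1,2)] by metis
  define q where "q u = (if u \<in> {0<..<1} then \<mu>.I u else 0)" for u
  have [measurable]: "q \<in> borel_measurable borel"
    unfolding q_def using \<mu>.measurable_CI
    by (subst (asm) measurable_restrict_space_iff[where c = 0]) auto
  define X where "X \<omega> = q (U \<omega>)" for \<omega>
  have X[measurable]: "X \<in> borel_measurable M" unfolding X_def by measurable
  have "distr M borel X = \<mu>"
  proof (rule cdf_unique)
    show "real_distribution (distr M borel X)"
      by (auto intro!: real_distribution_distr)
    show "real_distribution \<mu>" by fact
    show "cdf (distr M borel X) = cdf \<mu>"
    proof
      fix x
      have "cdf (distr M borel X) x = prob {\<omega>\<in>space M. X \<omega> \<le> x}"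
        by (simp add: cdf_def measure_distr vimage_def Int_def conj_commute)
      also have "\<dots> = prob {\<omega>\<in>space M. U \<omega> \<le> \<mu>.C x}"
      proof (rule finite_measure_eq_AE)
        show "AE \<omega> in M. \<omega> \<in> {\<omega> \<in> space M. X \<omega> \<le> x} \<longleftrightarrow> \<omega> \<in> {\<omega> \<in> space M. U \<omega> \<le> \<mu>.C x}"
          using U01 by eventually_elim (auto simp: X_def q_def \<mu>.pseudoinverse[symmetric])
      qed auto
      also have "\<dots> = \<mu>.C x" using \<mu>.cdf_bounded_prob[of x] \<mu>.cdf_nonneg[of x] by (intro U) auto
      finally show "cdf (distr M borel X) x = \<mu>.C x" .
    qed
  qed
  then show ?thesis using X that by blast
qed

section \<open>Reduction to the law of the logarithm\<close>

definition log_laws :: "(real measure \<Rightarrow> bool) \<Rightarrow> real measure set" where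
  "log_laws P = {\<mu>. real_distribution \<mu> \<and> (\<integral>\<^sup>+ x. ennreal (exp x) \<partial>\<mu>) \<le> 1 \<and> P \<mu>}"

definition tail_sup :: "(real measure \<Rightarrow> bool) \<Rightarrow> real \<Rightarrow> real" where
  "tail_sup P L = (SUP \<mu>\<in>log_laws P. measure \<mu> {L..})"

lemma e_variable_AE_finite:
  assumes "E \<in> e_variables M"
  shows "AE \<omega> in M. E \<omega> \<noteq> \<infinity>"
  using assms unfolding e_variables_def
  by (intro nn_integral_PInf_AE) (auto simp: top_unique)

lemma pos_e_variable_AE_exp_ln:
  assumes "prob_space M" "E \<in> pos_e_variables M"
  shows "AE \<omega> in M. E \<omega> = ennreal (exp (ln (enn2real (E \<omega>)))) \<and> enn2real (E \<omega>) > 0"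
proof -
  interpret prob_space M by fact
  have E: "E \<in> e_variables M" "prob {\<omega> \<in> space M. E \<omega> = 0} = 0"
    using assms(2) by (auto simp: pos_e_variables_def)
  then have [measurable]: "E \<in> borel_measurable M" by (auto simp: e_variables_def)
  have "AE \<omega> in M. \<omega> \<notin> {\<omega> \<in> space M. E \<omega> = 0}"
    using E(2) by (subst prob_eq_0[symmetric]) auto
  with e_variable_AE_finite[OF E(1)] AE_space show ?thesis
  proof eventually_elim
    case (elim \<omega>)
    then have "0 < enn2real (E \<omega>)"
      by (auto simp: enn2real_positive_iff zero_less_iff_neq_zero less_top)
    moreover have "E \<omega> = ennreal (enn2real (E \<omega>))" using elim by (auto simp: less_top)
    ultimately show ?case by simp
  qed
qed

text \<open>An e-variable in the class and its log-law have the same threshold probability, and every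
  admissible law \<open>\<mu>\<close> is attained by \<open>exp X\<close> for a random variable \<open>X\<close> with law \<open>\<mu>\<close>.\<close>
lemma R_eq_tail_sup:
  assumes "prob_space M" "atomless M" "0 < \<gamma>"
  shows "R M \<gamma> {E \<in> pos_e_variables M. P (log_law M E)} = tail_sup P (- ln \<gamma>)"
proof -
  interpret prob_space M by fact
  have "(\<lambda>E. prob {\<omega> \<in> space M. ennreal (1 / \<gamma>) \<le> E \<omega>}) ` {E \<in> pos_e_variables M. P (log_law M E)}
      = (\<lambda>\<mu>. measure \<mu> {- ln \<gamma>..}) ` log_laws P"
  proof (intro equalityI image_subsetI)
    fix E assume E: "E \<in> {E \<in> pos_e_variables M. P (log_law M E)}"
    then have [measurable]: "E \<in> borel_measurable M" and int: "(\<integral>\<^sup>+ \<omega>. E \<omega> \<partial>M) \<le> 1"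
      by (auto simp: pos_e_variables_def e_variables_def)
    have ae: "AE \<omega> in M. E \<omega> = ennreal (exp (ln (enn2real (E \<omega>)))) \<and> enn2real (E \<omega>) > 0"
      using E pos_e_variable_AE_exp_ln[OF assms(1)] by auto
    have "log_law M E \<in> log_laws P"
      unfolding log_laws_def
    proof (intro CollectI conjI)
      show "real_distribution (log_law M E)" unfolding log_law_def by (rule real_distribution_distr) measurable
      have "(\<integral>\<^sup>+ x. ennreal (exp x) \<partial>log_law M E) = (\<integral>\<^sup>+ \<omega>. ennreal (exp (ln (enn2real (E \<omega>)))) \<partial>M)"
        unfolding log_law_def by (rule nn_integral_distr) measurable
      also have "\<dots> = (\<integral>\<^sup>+ \<omega>. E \<omega> \<partial>M)"
      proof (rule nn_integral_cong_AE)
        show "AE \<omega> in M. ennreal (exp (ln (enn2real (E \<omega>)))) = E \<omega>"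
          using ae by (rule AE_mp) (auto intro!: AE_I2)
      qed
      finally show "(\<integral>\<^sup>+ x. ennreal (exp x) \<partial>log_law M E) \<le> 1" using int by simp
      show "P (log_law M E)" using E by simp
    qed
    moreover have "prob {\<omega> \<in> space M. ennreal (1 / \<gamma>) \<le> E \<omega>} = measure (log_law M E) {- ln \<gamma>..}"
    proof -
      have "measure (log_law M E) {- ln \<gamma>..} = prob {\<omega> \<in> space M. - ln \<gamma> \<le> ln (enn2real (E \<omega>))}"
        unfolding log_law_def by (simp add: measure_distr vimage_def Int_def conj_commute)
      also have "\<dots> = prob {\<omega> \<in> space M. ennreal (1 / \<gamma>) \<le> E \<omega>}"
      proof (rule finite_measure_eq_AE)
        show "AE \<omega> in M. \<omega> \<in> {\<omega> \<in> space M. - ln \<gamma> \<le> ln (enn2real (E \<omega>))}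
            \<longleftrightarrow> \<omega> \<in> {\<omega> \<in> space M. ennreal (1 / \<gamma>) \<le> E \<omega>}"
          using ae AE_space
        proof eventually_elim
          case (elim \<omega>)
          define y where "y = enn2real (E \<omega>)"
          have y: "0 < y" "E \<omega> = ennreal y" using elim by (auto simp: y_def)
          have "- ln \<gamma> = ln (1 / \<gamma>)" using assms(3) by (simp add: ln_div)
          then have "- ln \<gamma> \<le> ln y \<longleftrightarrow> 1 / \<gamma> \<le> y" using y assms(3) by (simp add: ln_le_cancel_iff)
          then show ?case using y elim(2) by (simp add: y_def[symmetric] ennreal_le_iff)
        qed
      qed measurable
      finally show ?thesis ..
    qed
    ultimately show "prob {\<omega> \<in> space M. ennreal (1 / \<gamma>) \<le> E \<omega>} \<in> (\<lambda>\<mu>. measure \<mu> {- ln \<gamma>..}) ` log_laws P"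
      by (rule rev_image_eqI)
  next
    fix \<mu> assume \<mu>: "\<mu> \<in> log_laws P"
    then have "real_distribution \<mu>" by (simp add: log_laws_def)
    then obtain X where [measurable]: "X \<in> borel_measurable M" and X: "distr M borel X = \<mu>"
      using atomless_has_every_law[OF assms(1,2)] by metis
    define E where "E \<omega> = ennreal (exp (X \<omega>))" for \<omega>
    have law: "log_law M E = \<mu>" unfolding log_law_def E_def using X by simp
    have "(\<integral>\<^sup>+ \<omega>. E \<omega> \<partial>M) = (\<integral>\<^sup>+ x. ennreal (exp x) \<partial>\<mu>)"
      unfolding E_def X[symmetric] by (rule nn_integral_distr[symmetric]) measurable
    moreover have "E \<in> borel_measurable M" unfolding E_def by measurable
    ultimately have "E \<in> pos_e_variables M"
      using \<mu> unfolding pos_e_variables_def e_variables_def by (simp add: log_laws_def E_def[abs_def])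
    then have "E \<in> {E \<in> pos_e_variables M. P (log_law M E)}"
      using \<mu> law by (simp add: log_laws_def)
    moreover have "measure \<mu> {- ln \<gamma>..} = prob {\<omega> \<in> space M. ennreal (1 / \<gamma>) \<le> E \<omega>}"
    proof -
      have "measure \<mu> {- ln \<gamma>..} = prob {\<omega> \<in> space M. - ln \<gamma> \<le> X \<omega>}"
        unfolding X[symmetric] by (simp add: measure_distr vimage_def Int_def conj_commute)
      moreover have "- ln \<gamma> \<le> x \<longleftrightarrow> ennreal (1 / \<gamma>) \<le> ennreal (exp x)" for x
      proof -
        have "1 / \<gamma> = exp (- ln \<gamma>)" using assms(3) by (simp add: exp_minus inverse_eq_divide)
        then show ?thesis by simp
      qed
      ultimately show ?thesis unfolding E_def by simp
    qed
    ultimately show "measure \<mu> {- ln \<gamma>..} \<in> (\<lambda>E. prob {\<omega> \<in> space M. ennreal (1 / \<gamma>) \<le> E \<omega>}) ` {E \<in> pos_e_variables M. P (log_law M E)}"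
      by (intro image_eqI[where x = E])
  qed
  then show ?thesis unfolding R_def tail_sup_def by simp
qed

lemma tail_sup_upper:
  assumes "\<mu> \<in> log_laws P"
  shows "measure \<mu> {L..} \<le> tail_sup P L"
  unfolding tail_sup_def
proof (rule cSUP_upper[OF assms])
  have "measure \<nu> {L..} \<le> 1" if "\<nu> \<in> log_laws P" for \<nu>
    using that by (auto simp: log_laws_def real_distribution_def intro: prob_space.prob_le_1)
  then show "bdd_above ((\<lambda>\<mu>. measure \<mu> {L..}) ` log_laws P)" by (intro bdd_aboveI[of _ 1]) auto
qed

lemma tail_sup_least:
  assumes "log_laws P \<noteq> {}" "\<And>\<mu>. \<mu> \<in> log_laws P \<Longrightarrow> measure \<mu> {L..} \<le> C"
  shows "tail_sup P L \<le> C"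
  unfolding tail_sup_def using assms by (rule cSUP_least)

lemma markov_log_law:
  assumes "\<mu> \<in> log_laws P"
  shows "measure \<mu> {L..} \<le> exp (- L)"
proof -
  interpret real_distribution \<mu> using assms by (simp add: log_laws_def)
  have "ennreal (exp L) * emeasure \<mu> {L..} = (\<integral>\<^sup>+x. ennreal (exp L) * indicator {L..} x \<partial>\<mu>)"
    by (subst nn_integral_cmult_indicator) auto
  also have "\<dots> \<le> (\<integral>\<^sup>+x. ennreal (exp x) \<partial>\<mu>)"
    by (intro nn_integral_mono) (auto split: split_indicator)
  also have "\<dots> \<le> 1" using assms by (simp add: log_laws_def)
  finally have "ennreal (exp L * prob {L..}) \<le> 1"
    by (simp add: emeasure_eq_measure ennreal_mult')
  then have "exp L * prob {L..} \<le> 1" by (simp add: ennreal_le_1)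
  then show ?thesis by (simp add: exp_minus field_simps)
qed

text \<open>The constant e-variable \<open>1\<close> shows that the suprema are taken over nonempty sets.\<close>
lemma return_0_in_log_laws:
  assumes "P (return borel 0)"
  shows "return borel 0 \<in> log_laws P"
  using assms unfolding log_laws_def
  by (auto simp: nn_integral_return real_distribution_def real_distribution_axioms_def prob_space_return)

section \<open>Mixtures and uniform laws\<close>

text \<open>The law \<open>p \<mu> + (1 - p) \<nu>\<close>, as a choice between \<open>\<mu>\<close> and \<open>\<nu>\<close> by a biased coin.\<close>
definition mix :: "real \<Rightarrow> real measure \<Rightarrow> real measure \<Rightarrow> real measure" where
  "mix p \<mu> \<nu> = measure_pmf (bernoulli_pmf p) \<bind> (\<lambda>b. if b then \<mu> else \<nu>)"

context
  fixes p :: real and \<mu> \<nu> :: "real measure"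
  assumes p: "0 \<le> p" "p \<le> 1" and \<mu>: "real_distribution \<mu>" and \<nu>: "real_distribution \<nu>"
begin

lemma mix_kernel:
  "(\<lambda>b. if b then \<mu> else \<nu>) \<in> measurable (measure_pmf (bernoulli_pmf p)) (subprob_algebra borel)"
  using \<mu> \<nu>
  by (auto simp: space_subprob_algebra real_distribution_def real_distribution_axioms_def
      intro: prob_space_imp_subprob_space split: if_splits)

lemma sets_mix: "sets (mix p \<mu> \<nu>) = sets borel"
  unfolding mix_def using \<mu> \<nu>
  by (intro sets_bind) (simp_all add: real_distribution_def real_distribution_axioms_def)

lemma emeasure_mix:
  assumes "A \<in> sets borel"
  shows "emeasure (mix p \<mu> \<nu>) A = ennreal p * emeasure \<mu> A + ennreal (1 - p) * emeasure \<nu> A"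
  unfolding mix_def using p
  by (subst emeasure_bind[OF _ mix_kernel assms]) (simp_all add: mult.commute)

lemma nn_integral_mix:
  assumes "f \<in> borel_measurable borel"
  shows "(\<integral>\<^sup>+ x. f x \<partial>mix p \<mu> \<nu>) = ennreal p * (\<integral>\<^sup>+ x. f x \<partial>\<mu>) + ennreal (1 - p) * (\<integral>\<^sup>+ x. f x \<partial>\<nu>)"
  unfolding mix_def using p
  by (subst nn_integral_bind[OF assms mix_kernel]) (simp_all add: mult.commute)

lemma real_distribution_mix: "real_distribution (mix p \<mu> \<nu>)"
proof -
  have "emeasure (mix p \<mu> \<nu>) UNIV = 1"
  proof -
    have "emeasure \<mu> UNIV = 1" "emeasure \<nu> UNIV = 1"
      using \<mu> \<nu> prob_space.emeasure_space_1[of \<mu>] prob_space.emeasure_space_1[of \<nu>]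
        real_distribution.space_eq_univ[of \<mu>] real_distribution.space_eq_univ[of \<nu>]
      by (auto simp: real_distribution_def)
    then show ?thesis using p by (simp add: emeasure_mix ennreal_plus[symmetric] del: ennreal_plus)
  qed
  then show ?thesis
    using sets_mix sets_eq_imp_space_eq[OF sets_mix]
    by (auto simp: real_distribution_def real_distribution_axioms_def intro!: prob_spaceI)
qed

lemma measure_mix:
  assumes "A \<in> sets borel"
  shows "measure (mix p \<mu> \<nu>) A = p * measure \<mu> A + (1 - p) * measure \<nu> A"
proof -
  interpret \<mu>: real_distribution \<mu> by (rule \<mu>)
  interpret \<nu>: real_distribution \<nu> by (rule \<nu>)
  interpret m: real_distribution "mix p \<mu> \<nu>" by (rule real_distribution_mix)
  have "ennreal (m.prob A) = ennreal p * ennreal (\<mu>.prob A) + ennreal (1 - p) * ennreal (\<nu>.prob A)"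
    using emeasure_mix[OF assms]
    by (simp only: \<mu>.emeasure_eq_measure \<nu>.emeasure_eq_measure m.emeasure_eq_measure)
  also have "\<dots> = ennreal (p * \<mu>.prob A + (1 - p) * \<nu>.prob A)"
    using p by (simp add: ennreal_mult'[symmetric])
  finally show ?thesis using p by (subst (asm) ennreal_inj) auto
qed

end

lemma real_distribution_return: "real_distribution (return borel (x::real))"
  by (simp add: real_distribution_def real_distribution_axioms_def prob_space_return)

definition uniform_law :: "real \<Rightarrow> real \<Rightarrow> real measure" where
  "uniform_law a b = density lborel (\<lambda>x. ennreal (indicator {a..b} x / (b - a)))"

lemma nn_integral_uniform_law:
  assumes "a < b" "f \<in> borel_measurable borel"
  shows "(\<integral>\<^sup>+ x. f x \<partial>uniform_law a b) = ennreal (1 / (b - a)) * (\<integral>\<^sup>+ x. f x * indicator {a..b} x \<partial>lborel)"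
  unfolding uniform_law_def using assms
  by (subst nn_integral_density)
     (auto simp: nn_integral_cmult[symmetric] mult_ac intro!: nn_integral_cong split: split_indicator)

lemma emeasure_uniform_law:
  assumes "a < b" "A \<in> sets borel"
  shows "emeasure (uniform_law a b) A = ennreal (1 / (b - a)) * emeasure lborel (A \<inter> {a..b})"
proof -
  have "emeasure (uniform_law a b) A = (\<integral>\<^sup>+ x. indicator A x \<partial>uniform_law a b)"
    using assms by (simp add: uniform_law_def)
  also have "\<dots> = ennreal (1 / (b - a)) * (\<integral>\<^sup>+ x. indicator (A \<inter> {a..b}) x \<partial>lborel)"
    using assms by (subst nn_integral_uniform_law) (auto simp: indicator_inter_arith[abs_def] simp del: nn_integral_indicator)
  also have "(\<integral>\<^sup>+ x. indicator (A \<inter> {a..b}) x \<partial>lborel) = emeasure lborel (A \<inter> {a..b})"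
    using assms by (intro nn_integral_indicator) auto
  finally show ?thesis .
qed

lemma real_distribution_uniform_law:
  assumes "a < b"
  shows "real_distribution (uniform_law a b)"
proof -
  have "emeasure (uniform_law a b) UNIV = 1"
    using assms by (simp add: emeasure_uniform_law ennreal_mult'[symmetric])
  then show ?thesis
    by (auto simp: real_distribution_def real_distribution_axioms_def uniform_law_def intro!: prob_spaceI)
qed

lemma nn_integral_exp_uniform_law:
  assumes "a < b"
  shows "(\<integral>\<^sup>+ x. ennreal (exp x) \<partial>uniform_law a b) = ennreal ((exp b - exp a) / (b - a))"
proof -
  have "(\<integral>\<^sup>+ x. ennreal (exp x) * indicator {a..b} x \<partial>lborel) = ennreal (exp b - exp a)"
    using assms by (intro nn_integral_FTC_Icc[where F = exp]) (auto intro!: derivative_eq_intros)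
  then show ?thesis
    using assms by (simp add: nn_integral_uniform_law ennreal_mult'[symmetric])
qed

lemma measure_uniform_law_tail:
  assumes "a \<le> L" "L \<le> b" "a < b"
  shows "measure (uniform_law a b) {L..} = (b - L) / (b - a)"
proof -
  have "{L..} \<inter> {a..b} = {L..b}" using assms by auto
  then show ?thesis using assms
    by (simp add: measure_def emeasure_uniform_law ennreal_mult'[symmetric])
qed

lemma atom_plus_density_uniform_law:
  assumes "a < b"
  shows "atom_plus_density UNIV x 0 (\<lambda>y. indicator {a..b} y / (b - a)) (uniform_law a b)"
  using assms unfolding atom_plus_density_def uniform_law_def by auto

lemma atom_plus_density_mix_uniform:
  assumes "0 \<le> p" "p \<le> 1" "a < b"
  shows "atom_plus_density UNIV x p (\<lambda>y. (1 - p) * (indicator {a..b} y / (b - a)))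
     (mix p (return borel x) (uniform_law a b))"
  unfolding atom_plus_density_def
proof (intro conjI ballI impI allI)
  fix A :: "real set" assume A: "A \<in> sets borel"
  have "emeasure (density lborel (\<lambda>y. ennreal ((1 - p) * (indicator {a..b} y / (b - a))))) A
      = (\<integral>\<^sup>+ y. ennreal (1 - p) * (ennreal (indicator {a..b} y / (b - a)) * indicator A y) \<partial>lborel)"
    using A assms
    by (subst emeasure_density) (auto intro!: nn_integral_cong simp: ennreal_mult mult.assoc simp del: times_divide_eq_right)
  also have "\<dots> = ennreal (1 - p) * emeasure (uniform_law a b) A"
    unfolding uniform_law_def using A by (simp add: nn_integral_cmult emeasure_density)
  finally show "emeasure (mix p (return borel x) (uniform_law a b)) A = ennreal p * indicator A x +
    emeasure (density lborel (\<lambda>y. ennreal ((1 - p) * (indicator {a..b} y / (b - a))))) A"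
    using A assms by (simp add: emeasure_mix real_distribution_return real_distribution_uniform_law)
qed (use assms in auto)

lemma atom_plus_density_return: "atom_plus_density UNIV x 1 (\<lambda>_. 0) (return borel x)"
  unfolding atom_plus_density_def by (auto simp: emeasure_density)

lemma atom_plus_density_subset:
  assumes "atom_plus_density UNIV x p f \<mu>"
  shows "atom_plus_density S x p f \<mu>"
  using assms unfolding atom_plus_density_def by auto

lemma atom_plus_density_away_from_atom:
  assumes "atom_plus_density UNIV x p f \<mu>" "x \<notin> S"
  shows "atom_plus_density S y 0 f \<mu>"
  using assms unfolding atom_plus_density_def by (auto simp: indicator_def)

section \<open>Symmetric log-laws\<close>

lemma nn_integral_reflect:
  assumes "distr \<mu> borel (\<lambda>y. c - y) = \<mu>" "real_distribution \<mu>" "f \<in> borel_measurable borel"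
  shows "(\<integral>\<^sup>+ y. f (c - y) \<partial>\<mu>) = (\<integral>\<^sup>+ y. f y \<partial>\<mu>)"
proof -
  interpret real_distribution \<mu> by fact
  have "(\<integral>\<^sup>+ y. f y \<partial>\<mu>) = (\<integral>\<^sup>+ y. f y \<partial>distr \<mu> borel (\<lambda>y. c - y))" using assms(1) by simp
  also have "\<dots> = (\<integral>\<^sup>+ y. f (c - y) \<partial>\<mu>)" using assms(3) by (intro nn_integral_distr) auto
  finally show ?thesis ..
qed

lemma measure_reflect:
  assumes "distr \<mu> borel (\<lambda>y. c - y) = \<mu>" "real_distribution \<mu>" "A \<in> sets borel"
  shows "measure \<mu> {y. c - y \<in> A} = measure \<mu> A"
proof -
  interpret real_distribution \<mu> by fact
  have "measure \<mu> A = measure (distr \<mu> borel (\<lambda>y. c - y)) A" using assms(1) by simp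
  also have "\<dots> = measure \<mu> {y. c - y \<in> A}" using assms(3) by (subst measure_distr) (auto simp: vimage_def)
  finally show ?thesis ..
qed

text \<open>Averaging \<open>exp\<close> over a point and its mirror image gives at least its value at the
  centre \<open>c / 2\<close>, so the exponential moment is at least \<open>e\<^bsup>c/2\<^esup>\<close>.\<close>
lemma symmetric_centre_le_0:
  assumes "distr \<mu> borel (\<lambda>y. c - y) = \<mu>" "real_distribution \<mu>" "(\<integral>\<^sup>+ x. ennreal (exp x) \<partial>\<mu>) \<le> 1"
  shows "c \<le> 0"
proof -
  interpret real_distribution \<mu> by fact
  have amgm: "2 * exp (c / 2) \<le> exp y + exp (c - y)" for y :: real
  proof -
    have "0 \<le> (exp (y / 2) - exp ((c - y) / 2))\<^sup>2" by simp
    also have "\<dots> = exp y + exp (c - y) - 2 * exp (c / 2)"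
      by (simp add: power2_diff power2_eq_square mult_exp_exp field_simps)
    finally show ?thesis by simp
  qed
  have "ennreal (2 * exp (c / 2)) = (\<integral>\<^sup>+ y. ennreal (2 * exp (c / 2)) \<partial>\<mu>)"
    using emeasure_space_1 by simp
  also have "\<dots> \<le> (\<integral>\<^sup>+ y. ennreal (exp y) + ennreal (exp (c - y)) \<partial>\<mu>)"
    using amgm by (intro nn_integral_mono) (simp flip: ennreal_plus)
  also have "\<dots> = (\<integral>\<^sup>+ y. ennreal (exp y) \<partial>\<mu>) + (\<integral>\<^sup>+ y. ennreal (exp (c - y)) \<partial>\<mu>)"
    by (intro nn_integral_add) auto
  also have "(\<integral>\<^sup>+ y. ennreal (exp (c - y)) \<partial>\<mu>) = (\<integral>\<^sup>+ y. ennreal (exp y) \<partial>\<mu>)"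
    using assms(1,2) by (rule nn_integral_reflect) measurable
  also have "(\<integral>\<^sup>+ y. ennreal (exp y) \<partial>\<mu>) + (\<integral>\<^sup>+ y. ennreal (exp y) \<partial>\<mu>) \<le> 1 + 1"
    using assms(3) by (intro add_mono)
  finally have "ennreal (2 * exp (c / 2)) \<le> ennreal 2" by simp
  then have "exp (c / 2) \<le> 1" by (subst (asm) ennreal_le_iff) auto
  then show ?thesis by simp
qed

text \<open>The tail beyond \<open>L\<close> and its mirror image are disjoint, because the centre lies below \<open>L\<close>.\<close>
lemma symmetric_tail_le_half:
  assumes "distr \<mu> borel (\<lambda>y. c - y) = \<mu>" "real_distribution \<mu>" "c \<le> 0" "0 < L"
  shows "measure \<mu> {L..} \<le> 1 / 2"
proof -
  interpret real_distribution \<mu> by fact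
  have "{y. c - y \<in> {L..}} = {..c - L}" by auto
  then have "prob {..c - L} = prob {L..}" using measure_reflect[OF assms(1,2), of "{L..}"] by simp
  moreover have "prob ({..c - L} \<union> {L..}) = prob {..c - L} + prob {L..}"
    using assms by (intro finite_measure_Union) auto
  moreover have "prob ({..c - L} \<union> {L..}) \<le> 1" by (rule prob_le_1)
  ultimately show ?thesis by linarith
qed

lemma ennreal_convex_comb:
  assumes "0 \<le> p" "p \<le> 1" "0 \<le> x" "0 \<le> y"
  shows "ennreal p * ennreal x + ennreal (1 - p) * ennreal y = ennreal (p * x + (1 - p) * y)"
  using assms by (simp add: ennreal_mult'[symmetric] flip: ennreal_plus)

lemma three_atom_symmetric:
  assumes "0 \<le> p" "p \<le> 1 / 2"
  shows "distr (mix (2 * p) (mix (1/2) (return borel L) (return borel (c - L))) (return borel (c / 2))) borel (\<lambda>y. c - y)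
      = mix (2 * p) (mix (1/2) (return borel L) (return borel (c - L))) (return borel (c / 2))"
    (is "distr ?\<mu> _ _ = _")
proof (rule measure_eqI)
  have m: "real_distribution (mix (1/2) (return borel L) (return borel (c - L)))"
    by (intro real_distribution_mix real_distribution_return) auto
  interpret real_distribution ?\<mu> using assms by (intro real_distribution_mix m real_distribution_return) auto
  have em: "emeasure ?\<mu> A = ennreal (2 * p) * (ennreal (1/2) * indicator A L + ennreal (1 - 1/2) * indicator A (c - L))
      + ennreal (1 - 2 * p) * indicator A (c / 2)" if "A \<in> sets borel" for A
    using that assms
    by (simp only: emeasure_mix[OF _ _ m real_distribution_return] emeasure_mix[OF _ _ real_distribution_return real_distribution_return])
       simp
  show "sets (distr ?\<mu> borel (\<lambda>y. c - y)) = sets ?\<mu>" by simp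
  fix A assume "A \<in> sets (distr ?\<mu> borel (\<lambda>y. c - y))"
  then have A: "A \<in> sets borel" by simp
  then have A': "(\<lambda>y. c - y) -` A \<in> sets borel"
    by (intro measurable_sets_borel) auto
  have "emeasure (distr ?\<mu> borel (\<lambda>y. c - y)) A = emeasure ?\<mu> ((\<lambda>y. c - y) -` A)"
    using A by (subst emeasure_distr) auto
  also have "\<dots> = emeasure ?\<mu> A"
    unfolding em[OF A] em[OF A'] by (simp add: indicator_def add.commute)
  finally show "emeasure (distr ?\<mu> borel (\<lambda>y. c - y)) A = emeasure ?\<mu> A" .
qed

text \<open>The extremal laws have mass \<open>p\<close> at \<open>L\<close> and at \<open>c - L\<close> and the remaining mass at \<open>c / 2\<close>. As \<open>c\<close>
  tends to \<open>- \<infinity>\<close>, only the atom at \<open>L\<close> contributes to the exponential moment.\<close>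
lemma tail_sup_symmetric:
  assumes "0 < L"
  shows "tail_sup symmetric_law L = min (exp (- L)) (1 / 2)"
proof (rule antisym)
  have ne: "return borel 0 \<in> log_laws symmetric_law"
    by (intro return_0_in_log_laws) (auto simp: symmetric_law_def distr_return intro!: exI[of _ 0])
  show "tail_sup symmetric_law L \<le> min (exp (- L)) (1 / 2)"
  proof (rule tail_sup_least)
    fix \<mu> assume \<mu>: "\<mu> \<in> log_laws symmetric_law"
    then obtain c where c: "distr \<mu> borel (\<lambda>y. c - y) = \<mu>" "real_distribution \<mu>" "(\<integral>\<^sup>+ x. ennreal (exp x) \<partial>\<mu>) \<le> 1"
      unfolding log_laws_def symmetric_law_def by auto
    show "measure \<mu> {L..} \<le> min (exp (- L)) (1 / 2)"
      using markov_log_law[OF \<mu>, of L] symmetric_tail_le_half[OF c(1,2) symmetric_centre_le_0[OF c] assms] by simp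
  qed (use ne in auto)
  show "min (exp (- L)) (1 / 2) \<le> tail_sup symmetric_law L"
  proof (rule field_le_mult_one_interval)
    fix \<theta> :: real assume \<theta>: "0 < \<theta>" "\<theta> < 1"
    define p where "p = \<theta> * min (exp (- L)) (1 / 2)"
    have p: "0 \<le> p" "p \<le> 1 / 2"
    proof -
      show "0 \<le> p" using \<theta> by (simp add: p_def)
      have "p \<le> 1 * (1 / 2)" unfolding p_def using \<theta> by (intro mult_mono) auto
      then show "p \<le> 1 / 2" by simp
    qed
    have pL: "p * exp L \<le> \<theta>"
    proof -
      have "p * exp L \<le> \<theta> * exp (- L) * exp L" unfolding p_def using \<theta> by (intro mult_right_mono mult_left_mono) auto
      then show ?thesis by (simp add: mult.assoc mult_exp_exp)
    qed
    \<comment> \<open>The atom at \<open>L\<close> uses up \<open>\<theta>\<close> of the exponential moment. For this \<open>c\<close> the other two use at most \<open>1 - \<theta>\<close>.\<close>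
    define c where "c = 2 * ln (1 - \<theta>)"
    have c: "exp (c / 2) = 1 - \<theta>" "c < 0" using \<theta> by (auto simp: c_def)
    have cL: "exp (c - L) \<le> 1 - \<theta>"
    proof -
      have "exp (c - L) \<le> exp (c / 2)" using c(2) assms by (subst exp_le_cancel_iff) linarith
      then show ?thesis using c(1) by simp
    qed
    let ?\<nu> = "mix (1/2) (return borel L) (return borel (c - L))"
    let ?\<mu> = "mix (2 * p) ?\<nu> (return borel (c / 2))"
    have \<nu>: "real_distribution ?\<nu>" by (intro real_distribution_mix real_distribution_return) auto
    have \<mu>: "real_distribution ?\<mu>" using p by (intro real_distribution_mix \<nu> real_distribution_return) auto
    have "(\<integral>\<^sup>+ x. ennreal (exp x) \<partial>?\<mu>) = ennreal (2 * p) * (ennreal (1/2) * ennreal (exp L) + ennreal (1 - 1/2) * ennreal (exp (c - L)))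
        + ennreal (1 - 2 * p) * ennreal (exp (c / 2))"
      using p by (simp add: nn_integral_mix \<nu> real_distribution_return nn_integral_return)
    also have "\<dots> = ennreal (2 * p) * ennreal (1/2 * exp L + (1 - 1/2) * exp (c - L)) + ennreal (1 - 2 * p) * ennreal (exp (c / 2))"
      by (subst ennreal_convex_comb) auto
    also have "\<dots> = ennreal (2 * p * (1/2 * exp L + (1 - 1/2) * exp (c - L)) + (1 - 2 * p) * exp (c / 2))"
      using p by (intro ennreal_convex_comb) auto
    also have "\<dots> \<le> ennreal 1"
    proof (rule ennreal_leI)
      have "2 * p * (1/2 * exp L + (1 - 1/2) * exp (c - L)) + (1 - 2 * p) * exp (c / 2)
          = p * exp L + p * exp (c - L) + (1 - 2 * p) * (1 - \<theta>)" unfolding c(1) by (simp add: algebra_simps)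
      also have "\<dots> \<le> \<theta> + p * (1 - \<theta>) + (1 - 2 * p) * (1 - \<theta>)"
        using pL cL p by (intro add_mono mult_left_mono) auto
      also have "\<dots> = \<theta> + (1 - p) * (1 - \<theta>)" by (simp add: algebra_simps)
      also have "\<dots> \<le> \<theta> + 1 * (1 - \<theta>)" using p \<theta> by (intro add_left_mono mult_right_mono) auto
      finally show "2 * p * (1/2 * exp L + (1 - 1/2) * exp (c - L)) + (1 - 2 * p) * exp (c / 2) \<le> 1" by simp
    qed
    finally have "?\<mu> \<in> log_laws symmetric_law"
      unfolding log_laws_def symmetric_law_def using \<mu> three_atom_symmetric[OF p, of L c] by auto
    then have "measure ?\<mu> {L..} \<le> tail_sup symmetric_law L" by (rule tail_sup_upper)
    moreover have "measure ?\<mu> {L..} = p"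
      using p c assms by (simp add: measure_mix \<nu> real_distribution_return measure_return)
    ultimately show "\<theta> * min (exp (- L)) (1 / 2) \<le> tail_sup symmetric_law L" by (simp add: p_def)
  qed
qed

section \<open>Unimodal log-laws\<close>

lemma unimodal_mix_uniform:
  assumes "0 \<le> p" "p \<le> 1" "c < L"
  shows "unimodal_law (mix p (return borel L) (uniform_law c L))"
proof -
  have "mono_on {..<L} (\<lambda>y. (1 - p) * (indicator {c..L} y / (L - c)))"
    using assms by (intro mono_onI mult_left_mono divide_right_mono) (auto split: split_indicator)
  moreover have "antimono_on {L<..} (\<lambda>y. (1 - p) * (indicator {c..L} y / (L - c)))"
    by (intro monotone_onI) (auto split: split_indicator)
  ultimately show ?thesis
    unfolding unimodal_law_def using atom_plus_density_mix_uniform[OF assms] by blast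
qed

lemma unimodal_return: "unimodal_law (return borel x)"
  unfolding unimodal_law_def
  using atom_plus_density_return[of x] by (intro exI conjI) (auto intro!: monotone_onI)

lemma tail_sup_unimodal:
  assumes "0 \<le> L"
  shows "tail_sup unimodal_law L = exp (- L)"
proof (rule antisym)
  show "tail_sup unimodal_law L \<le> exp (- L)"
    using return_0_in_log_laws[of unimodal_law] unimodal_return markov_log_law by (intro tail_sup_least) auto
  show "exp (- L) \<le> tail_sup unimodal_law L"
  proof (rule field_le_mult_one_interval)
    fix \<theta> :: real assume \<theta>: "0 < \<theta>" "\<theta> < 1"
    define p where "p = \<theta> * exp (- L)"
    have "p \<le> 1 * 1" unfolding p_def using \<theta> assms by (intro mult_mono) auto
    then have p: "0 \<le> p" "p \<le> 1" using \<theta> by (auto simp: p_def)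
    have pL: "p * exp L = \<theta>" by (simp add: p_def exp_minus)
    \<comment> \<open>The atom at \<open>L\<close> uses up \<open>\<theta>\<close> of the exponential moment. The interval \<open>[c, L]\<close> is so long that
      the uniform law on it has exponential moment at most \<open>e\<^sup>L / (L - c) = 1 - \<theta>\<close>.\<close>
    define c where "c = L - exp L / (1 - \<theta>)"
    have cL: "c < L" using \<theta> by (simp add: c_def)
    have d: "exp L / (L - c) = 1 - \<theta>" using \<theta> by (simp add: c_def)
    let ?\<mu> = "mix p (return borel L) (uniform_law c L)"
    have U: "real_distribution (uniform_law c L)" using cL by (rule real_distribution_uniform_law)
    have \<mu>: "real_distribution ?\<mu>" using p U by (intro real_distribution_mix real_distribution_return) auto
    have "(\<integral>\<^sup>+ x. ennreal (exp x) \<partial>?\<mu>) = ennreal (p * exp L + (1 - p) * ((exp L - exp c) / (L - c)))"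
      using p cL by (simp add: nn_integral_mix U real_distribution_return nn_integral_return nn_integral_exp_uniform_law
          ennreal_mult'[symmetric] del: times_divide_eq_right flip: ennreal_plus)
    also have "\<dots> \<le> ennreal 1"
    proof (rule ennreal_leI)
      have "(exp L - exp c) / (L - c) \<le> exp L / (L - c)" using cL by (intro divide_right_mono) auto
      then have "(1 - p) * ((exp L - exp c) / (L - c)) \<le> 1 * (1 - \<theta>)"
        unfolding d using p \<theta> cL by (intro mult_mono) auto
      then show "p * exp L + (1 - p) * ((exp L - exp c) / (L - c)) \<le> 1" using pL by simp
    qed
    finally have "?\<mu> \<in> log_laws unimodal_law"
      unfolding log_laws_def using \<mu> unimodal_mix_uniform[OF p cL] by auto
    then have "measure ?\<mu> {L..} \<le> tail_sup unimodal_law L" by (rule tail_sup_upper)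
    moreover have "measure ?\<mu> {L..} = p"
      using p cL by (simp add: measure_mix U real_distribution_return measure_return measure_uniform_law_tail)
    ultimately show "\<theta> * exp (- L) \<le> tail_sup unimodal_law L" by (simp add: p_def)
  qed
qed

lemma tail_sup_0:
  assumes "P (return borel 0)"
  shows "tail_sup P 0 = 1"
proof (rule antisym)
  have r: "return borel 0 \<in> log_laws P" using assms by (rule return_0_in_log_laws)
  show "tail_sup P 0 \<le> 1"
  proof (rule tail_sup_least)
    show "log_laws P \<noteq> {}" using r by auto
    fix \<mu> assume "\<mu> \<in> log_laws P"
    then show "measure \<mu> {0..} \<le> 1" using markov_log_law[of \<mu> P 0] by simp
  qed
  have "measure (return borel (0::real)) {0..} = 1" by (simp add: measure_return)
  then show "1 \<le> tail_sup P 0" using tail_sup_upper[OF r, of 0] by simp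
qed

section \<open>Flattening a decreasing density\<close>

lemma nn_integral_on_density_part:
  assumes apd: "atom_plus_density S x p f \<mu>" and T: "T \<in> sets borel" "T \<subseteq> S" "x \<notin> T"
    and \<mu>: "real_distribution \<mu>" and h: "h \<in> borel_measurable borel"
  shows "(\<integral>\<^sup>+ y. h y * indicator T y \<partial>\<mu>) = (\<integral>\<^sup>+ y. h y * (ennreal (f y) * indicator T y) \<partial>lborel)"
proof -
  interpret real_distribution \<mu> by (rule \<mu>)
  have [measurable]: "f \<in> borel_measurable borel" using apd by (simp add: atom_plus_density_def)
  note T(1)[measurable]
  have eq: "density \<mu> (indicator T) = density lborel (\<lambda>y. ennreal (f y) * indicator T y)"
  proof (rule measure_eqI)
    fix A assume "A \<in> sets (density \<mu> (indicator T))"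
    then have A[measurable]: "A \<in> sets borel" by simp
    have "emeasure (density \<mu> (indicator T)) A = (\<integral>\<^sup>+ y. indicator (A \<inter> T) y \<partial>\<mu>)"
      by (subst emeasure_density) (auto intro!: nn_integral_cong simp del: nn_integral_indicator split: split_indicator)
    also have "\<dots> = emeasure \<mu> (A \<inter> T)" by (intro nn_integral_indicator) simp
    also have "\<dots> = emeasure (density lborel (\<lambda>y. ennreal (f y))) (A \<inter> T)"
    proof -
      have "A \<inter> T \<in> sets borel" "A \<inter> T \<subseteq> S" using T by auto
      then have "emeasure \<mu> (A \<inter> T) = ennreal p * indicator (A \<inter> T) x
          + emeasure (density lborel (\<lambda>y. ennreal (f y))) (A \<inter> T)"
        using apd unfolding atom_plus_density_def by blast
      then show ?thesis using T(3) by simp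
    qed
    also have "\<dots> = emeasure (density lborel (\<lambda>y. ennreal (f y) * indicator T y)) A"
      by (subst (1 2) emeasure_density) (auto intro!: nn_integral_cong split: split_indicator)
    finally show "emeasure (density \<mu> (indicator T)) A = emeasure (density lborel (\<lambda>y. ennreal (f y) * indicator T y)) A" .
  qed simp
  have "(\<integral>\<^sup>+ y. h y * indicator T y \<partial>\<mu>) = (\<integral>\<^sup>+ y. h y \<partial>density \<mu> (indicator T))"
    using h by (subst nn_integral_density) (auto simp: mult.commute)
  also have "\<dots> = (\<integral>\<^sup>+ y. h y * (ennreal (f y) * indicator T y) \<partial>lborel)"
    unfolding eq using h by (subst nn_integral_density) (auto simp: mult.commute)
  finally show ?thesis .
qed

text \<open>The density is stated through integrals instead of measures of sets, because it is applied to
  exponential moments. It only concerns the open half-line, so that an atom at \<open>a\<close> does not interfere.\<close>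
definition has_decreasing_density_beyond :: "real \<Rightarrow> (real \<Rightarrow> real) \<Rightarrow> real measure \<Rightarrow> bool" where
  "has_decreasing_density_beyond a f \<mu> \<longleftrightarrow>
     f \<in> borel_measurable borel \<and> (\<forall>y. 0 \<le> f y) \<and> antimono_on {a<..} f \<and>
     (\<forall>h\<in>borel_measurable borel. (\<integral>\<^sup>+ y. h y * indicator {a<..} y \<partial>\<mu>)
        = (\<integral>\<^sup>+ y. h y * (ennreal (f y) * indicator {a<..} y) \<partial>lborel))"

lemma has_decreasing_density_beyondI:
  assumes "atom_plus_density S x p f \<mu>" "{a<..} \<subseteq> S" "x \<le> a" "antimono_on {a<..} f" "real_distribution \<mu>"
  shows "has_decreasing_density_beyond a f \<mu>"
  unfolding has_decreasing_density_beyond_def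
  using assms nn_integral_on_density_part[OF assms(1) _ assms(2) _ assms(5)]
  by (auto simp: atom_plus_density_def)

context
  fixes \<mu> :: "real measure" and a L q :: real and f :: "real \<Rightarrow> real"
  assumes \<mu>: "real_distribution \<mu>" and dens: "has_decreasing_density_beyond a f \<mu>" and aL: "a < L"
    and q: "q = measure \<mu> {L..}" "0 < q"
begin

lemma tail_eq_integral: "(\<integral>\<^sup>+ y. ennreal (f y) * indicator {L..} y \<partial>lborel) = ennreal q"
proof -
  interpret real_distribution \<mu> by (rule \<mu>)
  have "ennreal q = (\<integral>\<^sup>+ y. indicator {L..} y \<partial>\<mu>)" by (simp add: q(1) emeasure_eq_measure)
  also have "\<dots> = (\<integral>\<^sup>+ y. indicator {L..} y * indicator {a<..} y \<partial>\<mu>)"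
    using aL by (intro nn_integral_cong) (auto split: split_indicator)
  also have "\<dots> = (\<integral>\<^sup>+ y. indicator {L..} y * (ennreal (f y) * indicator {a<..} y) \<partial>lborel)"
    using dens unfolding has_decreasing_density_beyond_def by auto
  also have "\<dots> = (\<integral>\<^sup>+ y. ennreal (f y) * indicator {L..} y \<partial>lborel)"
    using aL by (intro nn_integral_cong) (auto split: split_indicator)
  finally show ?thesis ..
qed

lemma density_at_threshold_pos: "0 < f L"
proof (rule ccontr)
  assume "\<not> 0 < f L"
  then have "f L \<le> 0" by simp
  have "f y = 0" if "L \<le> y" for y
  proof -
    have "f y \<le> f L" using dens that aL unfolding has_decreasing_density_beyond_def
      by (auto intro: monotone_onD)
    then show ?thesis using \<open>f L \<le> 0\<close> dens unfolding has_decreasing_density_beyond_def by (auto intro: antisym order_trans)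
  qed
  then have "(\<integral>\<^sup>+ y. ennreal (f y) * indicator {L..} y \<partial>lborel) = (\<integral>\<^sup>+ y. 0 \<partial>(lborel :: real measure))"
    by (intro nn_integral_cong) (auto split: split_indicator)
  then show False using tail_eq_integral q(2) by simp
qed

text \<open>
  Compare \<open>f\<close> with \<open>v = f L\<close> on \<open>(a, b]\<close>, where \<open>b = L + q / v\<close> makes both tails beyond \<open>L\<close> equal
  to \<open>q\<close>. Below \<open>L\<close> one has \<open>f \<ge> v\<close>, so the comparison holds pointwise. Beyond \<open>L\<close> the difference of \<open>f\<close>
  and \<open>v 1\<^bsub>(a,b]\<^esub>\<close> has integral \<open>0\<close> and changes sign from negative to positive at \<open>b\<close>; hence it
  does no harm to subtract the constant \<open>k b\<close> from \<open>k\<close> there, and then beyond \<open>L\<close> the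
  two factors have the same sign everywhere.
\<close>
lemma flatten_density:
  assumes k: "k \<in> borel_measurable borel" "\<And>y. a < y \<Longrightarrow> 0 \<le> k y" "mono_on {a<..} k"
  shows "ennreal (f L) * (\<integral>\<^sup>+ y. ennreal (k y) * indicator {a..L + q / f L} y \<partial>lborel)
       \<le> (\<integral>\<^sup>+ y. ennreal (k y) * indicator {a<..} y \<partial>\<mu>)"
proof -
  define v where "v = f L"
  have v: "0 < v" using density_at_threshold_pos by (simp add: v_def)
  define b where "b = L + q / v"
  have b: "L < b" using v q by (simp add: b_def)
  define \<kappa> where "\<kappa> = k b"
  have \<kappa>: "0 \<le> \<kappa>" using k(2)[of b] b aL by (simp add: \<kappa>_def)
  have [measurable]: "f \<in> borel_measurable borel" "k \<in> borel_measurable borel"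
    using dens k unfolding has_decreasing_density_beyond_def by auto
  have f0: "0 \<le> f y" for y using dens unfolding has_decreasing_density_beyond_def by auto
  have fdec: "f z \<le> f y" if "a < y" "y \<le> z" for y z
    using dens that unfolding has_decreasing_density_beyond_def by (auto intro: monotone_onD)
  have kinc: "k y \<le> k z" if "a < y" "y \<le> z" for y z
    using k(3) that by (auto intro: monotone_onD)
  let ?F = "\<lambda>y. ennreal (k y) * (ennreal (f y) * indicator {a<..} y)"
  let ?G = "\<lambda>y. ennreal (k y) * (ennreal v * indicator {a<..b} y)"
  let ?A = "\<lambda>y. ennreal \<kappa> * (ennreal (f y) * indicator {L..} y)"
  let ?B = "\<lambda>y. ennreal \<kappa> * (ennreal v * indicator {L..b} y)"
  \<comment> \<open>The sign argument, with all subtractions moved to the other side to stay in \<open>[0, \<infinity>]\<close>: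
    \<open>?A\<close> and \<open>?B\<close> carry the subtracted constant and have equal finite integrals.\<close>
  have pt: "?G y + ?A y \<le> ?F y + ?B y" for y
  proof -
    consider "y \<le> a" | "a < y" "y < L" | "L \<le> y" "y \<le> b" | "b < y" by linarith
    then show ?thesis
    proof cases
      case 1
      then show ?thesis using aL by simp
    next
      case 2
      then have "k y * v \<le> k y * f y" using fdec[of y L] k(2) by (auto simp: v_def intro: mult_left_mono)
      then show ?thesis using 2 b k(2)[of y] f0 v by (simp add: ennreal_mult'[symmetric])
    next
      case 3
      have "0 \<le> (\<kappa> - k y) * (v - f y)"
        using 3 kinc[of y b] fdec[of L y] aL by (auto simp: v_def \<kappa>_def)
      then have "k y * v + \<kappa> * f y \<le> k y * f y + \<kappa> * v" by (simp add: algebra_simps)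
      then show ?thesis using 3 aL k(2)[of y] f0[of y] v \<kappa>
        by (simp add: ennreal_mult'[symmetric] flip: ennreal_plus)
    next
      case 4
      then have "\<kappa> * f y \<le> k y * f y" using kinc[of b y] b aL f0 by (auto simp: \<kappa>_def intro: mult_right_mono)
      then show ?thesis using 4 b aL k(2)[of y] f0[of y] v \<kappa> by (simp add: ennreal_mult'[symmetric])
    qed
  qed
  have A: "(\<integral>\<^sup>+ y. ?A y \<partial>lborel) = ennreal (\<kappa> * q)"
    using \<kappa> by (simp add: nn_integral_cmult tail_eq_integral ennreal_mult')
  have B: "(\<integral>\<^sup>+ y. ?B y \<partial>lborel) = ennreal (\<kappa> * q)"
  proof -
    have "(\<integral>\<^sup>+ y. ennreal v * indicator {L..b} y \<partial>lborel) = ennreal v * ennreal (b - L)"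
      using b by (simp add: nn_integral_cmult_indicator)
    also have "\<dots> = ennreal q" using v b by (simp add: ennreal_mult'[symmetric] b_def)
    finally show ?thesis using \<kappa> by (simp add: nn_integral_cmult ennreal_mult')
  qed
  have "(\<integral>\<^sup>+ y. ?G y \<partial>lborel) + ennreal (\<kappa> * q) = (\<integral>\<^sup>+ y. ?G y + ?A y \<partial>lborel)"
    unfolding A[symmetric] by (intro nn_integral_add[symmetric]) measurable
  also have "\<dots> \<le> (\<integral>\<^sup>+ y. ?F y + ?B y \<partial>lborel)" using pt by (intro nn_integral_mono) auto
  also have "\<dots> = (\<integral>\<^sup>+ y. ?F y \<partial>lborel) + ennreal (\<kappa> * q)"
    unfolding B[symmetric] by (intro nn_integral_add) measurable
  finally have "(\<integral>\<^sup>+ y. ?G y \<partial>lborel) \<le> (\<integral>\<^sup>+ y. ?F y \<partial>lborel)"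
    by (simp add: ennreal_add_left_cancel_le add.commute[of _ "ennreal (\<kappa> * q)"])
  moreover have "(\<integral>\<^sup>+ y. ?F y \<partial>lborel) = (\<integral>\<^sup>+ y. ennreal (k y) * indicator {a<..} y \<partial>\<mu>)"
    using dens unfolding has_decreasing_density_beyond_def by auto
  moreover have "(\<integral>\<^sup>+ y. ?G y \<partial>lborel) = ennreal v * (\<integral>\<^sup>+ y. ennreal (k y) * indicator {a..b} y \<partial>lborel)"
  proof -
    have "(\<integral>\<^sup>+ y. ?G y \<partial>lborel) = (\<integral>\<^sup>+ y. ennreal v * (ennreal (k y) * indicator {a..b} y) \<partial>lborel)"
    proof (rule nn_integral_cong_AE)
      show "AE y in lborel. ?G y = ennreal v * (ennreal (k y) * indicator {a..b} y)"
        using AE_lborel_singleton[of a] by eventually_elim (auto split: split_indicator simp: mult_ac)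
    qed
    then show ?thesis by (simp add: nn_integral_cmult)
  qed
  ultimately show ?thesis by (simp add: v_def b_def)
qed

text \<open>Flattening with the constant function \<open>k = 1\<close>.\<close>
lemma flattened_mass_le: "f L * (L + q / f L - a) \<le> measure \<mu> {a<..}"
proof -
  interpret real_distribution \<mu> by (rule \<mu>)
  note v = density_at_threshold_pos
  have "0 \<le> q / f L" using v q(2) by simp
  have "ennreal (f L * (L + q / f L - a)) = ennreal (f L) * (\<integral>\<^sup>+ y. ennreal 1 * indicator {a..L + q / f L} y \<partial>lborel)"
    using v aL \<open>0 \<le> q / f L\<close> by (simp add: ennreal_mult)
  also have "\<dots> \<le> (\<integral>\<^sup>+ y. ennreal 1 * indicator {a<..} y \<partial>\<mu>)"
    by (rule flatten_density) (auto intro: monotone_onI)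
  also have "\<dots> = ennreal (prob {a<..})" by (simp add: emeasure_eq_measure)
  finally show ?thesis by simp
qed

end

section \<open>Log-laws with decreasing density on the positive half-line\<close>

lemma uniform_in_log_laws:
  assumes "a < b" "exp b - exp a \<le> b - a" "P (uniform_law a b)"
  shows "uniform_law a b \<in> log_laws P"
proof -
  have "(exp b - exp a) / (b - a) \<le> 1" using assms by simp
  then show ?thesis
    using assms unfolding log_laws_def
    by (simp add: real_distribution_uniform_law nn_integral_exp_uniform_law)
qed

lemma x_times_one_minus_ln_strict_antimono:
  fixes x y :: real
  assumes "1 \<le> x" "x < y"
  shows "y * (1 - ln y) < x * (1 - ln x)"
proof (rule DERIV_neg_imp_decreasing_open[OF assms(2)])
  fix t assume "x < t" "t < y"
  then have "0 < t" "1 < t" using assms by auto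
  then show "\<exists>d. DERIV (\<lambda>t. t * (1 - ln t)) t :> d \<and> d < 0"
    by (intro exI[of _ "- ln t"] conjI) (auto intro!: derivative_eq_intros)
next
  show "continuous_on {x..y} (\<lambda>t. t * (1 - ln t))" using assms by (intro continuous_intros) auto
qed

lemma is_t_antimono:
  assumes "is_t \<gamma> s" "is_t \<delta> t" "\<gamma> \<le> \<delta>"
  shows "t \<le> s"
  using x_times_one_minus_ln_strict_antimono[of s t] assms unfolding is_t_def by linarith

lemma t_exists_unique:
  assumes "0 < \<gamma>" "\<gamma> \<le> 1"
  shows "\<exists>!t. is_t \<gamma> t"
proof -
  have "\<exists>t\<ge>1. t \<le> exp 1 \<and> t * (1 - ln t) = \<gamma>"
    using assms by (intro IVT2') (auto intro!: continuous_intros)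
  then obtain t where t: "1 \<le> t" "t \<le> exp 1" "t * (1 - ln t) = \<gamma>" by auto
  have "t \<noteq> exp 1" using t assms by auto
  then have "is_t \<gamma> t" using t by (simp add: is_t_def)
  moreover have "s = t" if "is_t \<gamma> s" for s
    using is_t_antimono[OF that \<open>is_t \<gamma> t\<close>] is_t_antimono[OF \<open>is_t \<gamma> t\<close> that] by simp
  ultimately show ?thesis by blast
qed

lemma is_t_t_sol:
  assumes "0 < \<gamma>" "\<gamma> \<le> 1"
  shows "is_t \<gamma> (t_sol \<gamma>)"
  unfolding t_sol_def using t_exists_unique[OF assms] by (rule theI')

lemma is_t_1_1: "is_t 1 1"
  by (simp add: is_t_def)

text \<open>Since \<open>t \<ge> 1\<close>, the equation gives \<open>1 - ln t \<le> \<gamma>\<close>; this makes \<open>t\<close> tend to \<open>e\<close> as \<open>\<gamma>\<close> tends to \<open>0\<close>.\<close>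
lemma is_t_ge_exp:
  assumes "is_t \<gamma> t"
  shows "exp (1 - \<gamma>) \<le> t"
proof -
  have t: "1 \<le> t" "t < exp 1" "t * (1 - ln t) = \<gamma>" using assms by (auto simp: is_t_def)
  have "ln t < 1" using t ln_less_cancel_iff[of t "exp 1"] by simp
  then have "1 * (1 - ln t) \<le> t * (1 - ln t)" using t by (intro mult_right_mono) auto
  then have "1 - \<gamma> \<le> ln t" using t by simp
  then show ?thesis using t by (simp add: ln_ge_iff)
qed

lemma is_t_le_exp_minus:
  assumes "is_t \<gamma> t"
  shows "t \<le> exp 1 - \<gamma>"
proof -
  have t: "1 \<le> t" "t < exp 1" "t * (1 - ln t) = \<gamma>" using assms by (auto simp: is_t_def)
  have "1 + (1 - ln t) \<le> exp (1 - ln t)" by (rule exp_ge_add_one_self)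
  then have "t * (1 + (1 - ln t)) \<le> t * exp (1 - ln t)" using t by (intro mult_left_mono) auto
  also have "\<dots> = exp 1" using t by (simp add: exp_diff)
  finally show ?thesis using t by (simp add: algebra_simps)
qed

text \<open>
  With \<open>c = 1 - ln t\<close> the equation for \<open>t\<close> says \<open>L = - ln c - (1 - c)\<close>. Flattening bounds the
  moment from below by \<open>v (e\<^sup>b - 1)\<close> while the tail is \<open>v (b - L)\<close>, so it suffices that
  \<open>b - L \<le> c (e\<^sup>b - 1)\<close>. This is the tangent inequality \<open>1 + x \<le> e\<^sup>x\<close> at \<open>x = b + ln c\<close>.
\<close>
lemma decreasing_from_0_tail_le:
  assumes \<mu>: "\<mu> \<in> log_laws (decreasing_law_from 0)" and L: "0 < L" and t: "is_t (exp (- L)) t"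
  shows "measure \<mu> {L..} \<le> 1 - ln t"
proof (cases "measure \<mu> {L..} = 0")
  case True
  have "ln t < 1" using t ln_less_cancel_iff[of t "exp 1"] by (simp add: is_t_def)
  then show ?thesis using True by simp
next
  case False
  define q where "q = measure \<mu> {L..}"
  have q: "0 < q" using False by (simp add: q_def zero_less_measure_iff)
  define c where "c = 1 - ln t"
  have tt: "1 \<le> t" "t < exp 1" "t * c = exp (- L)" using t by (auto simp: is_t_def c_def)
  have c: "0 < c" using tt ln_less_cancel_iff[of t "exp 1"] by (simp add: c_def)
  have "- L = ln (t * c)" using tt(3) by simp
  also have "\<dots> = ln t + ln c" using tt(1) c by (intro ln_mult_pos) auto
  finally have Lc: "L = - ln c - (1 - c)" unfolding c_def by linarith
  have rd: "real_distribution \<mu>" and int: "(\<integral>\<^sup>+ x. ennreal (exp x) \<partial>\<mu>) \<le> 1"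
    using \<mu> by (auto simp: log_laws_def)
  obtain p f where "atom_plus_density {0..} 0 p f \<mu>" "antimono_on {0<..} f"
    using \<mu> unfolding log_laws_def decreasing_law_from_def by auto
  then have dens: "has_decreasing_density_beyond 0 f \<mu>"
    using rd by (intro has_decreasing_density_beyondI) auto
  note ctx = rd dens L q_def q
  define v where "v = f L"
  have v: "0 < v" unfolding v_def by (rule density_at_threshold_pos[OF ctx])
  define b where "b = L + q / v"
  have bL: "L < b" using v q by (simp add: b_def)
  have "ennreal (v * (exp b - exp 0)) = ennreal v * (\<integral>\<^sup>+ y. ennreal (exp y) * indicator {0..b} y \<partial>lborel)"
  proof -
    have "(\<integral>\<^sup>+ y. ennreal (exp y) * indicator {0..b} y \<partial>lborel) = ennreal (exp b - exp 0)"
      using bL L by (intro nn_integral_FTC_Icc[where F = exp]) (auto intro!: derivative_eq_intros)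
    then show ?thesis using v by (simp add: ennreal_mult')
  qed
  also have "\<dots> \<le> (\<integral>\<^sup>+ y. ennreal (exp y) * indicator {0<..} y \<partial>\<mu>)"
    unfolding v_def b_def by (rule flatten_density[OF ctx]) (auto intro!: monotone_onI)
  also have "\<dots> \<le> (\<integral>\<^sup>+ y. ennreal (exp y) \<partial>\<mu>)" by (intro nn_integral_mono) (auto split: split_indicator)
  also have "\<dots> \<le> ennreal 1" using int by simp
  finally have E: "v * (exp b - 1) \<le> 1" by (subst (asm) ennreal_le_iff) auto
  have "b - L = (1 + (b + ln c)) - c" using Lc by simp
  also have "\<dots> \<le> exp (b + ln c) - c" using exp_ge_add_one_self[of "b + ln c"] by simp
  also have "\<dots> = c * (exp b - 1)" using c by (simp add: exp_add algebra_simps)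
  finally have "v * (b - L) \<le> v * (c * (exp b - 1))" using v by (intro mult_left_mono) auto
  also have "\<dots> = c * (v * (exp b - 1))" by simp
  also have "\<dots> \<le> c * 1" using c E by (intro mult_left_mono) auto
  finally show ?thesis using v by (simp add: b_def c_def q_def)
qed

text \<open>
  Equality in the tangent inequality forces \<open>b = - ln c\<close>. The uniform law on \<open>[0, b]\<close> is given the largest weight
  that the moment allows, up to a factor \<open>\<theta> < 1\<close>, and the remaining mass is put at a negative point
  \<open>x\<close>, where it costs at most \<open>e\<^sup>x = 1 - \<theta>\<close>.
\<close>
lemma decreasing_from_0_tail_sup_ge:
  assumes L: "0 < L" and t: "is_t (exp (- L)) t"
  shows "1 - ln t \<le> tail_sup (decreasing_law_from 0) L"
proof -
  define c where "c = 1 - ln t"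
  have tt: "1 \<le> t" "t < exp 1" "t * c = exp (- L)" using t by (auto simp: is_t_def c_def)
  have c: "0 < c" using tt ln_less_cancel_iff[of t "exp 1"] by (simp add: c_def)
  have "t \<noteq> 1" using tt L by (auto simp: c_def)
  then have c1: "c < 1" using tt by (simp add: c_def)
  have "- L = ln (t * c)" using tt(3) by simp
  also have "\<dots> = ln t + ln c" using tt(1) c by (intro ln_mult_pos) auto
  finally have Lc: "L = - ln c - (1 - c)" unfolding c_def by linarith
  define b where "b = - ln c"
  have b: "0 < b" "exp b = 1 / c" "b - L = 1 - c" "L \<le> b"
    using c c1 Lc by (auto simp: b_def exp_minus inverse_eq_divide)
  have eb: "b \<le> exp b - 1" using exp_ge_add_one_self[of b] by linarith
  have "c \<le> tail_sup (decreasing_law_from 0) L"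
  proof (rule field_le_mult_one_interval)
    fix \<theta> :: real assume \<theta>: "0 < \<theta>" "\<theta> < 1"
    define w where "w = \<theta> * (b / (exp b - 1))"
    have "b / (exp b - 1) \<le> 1" using eb b by simp
    then have "w \<le> 1 * 1" unfolding w_def using \<theta> eb b by (intro mult_mono) auto
    moreover have "0 \<le> w" unfolding w_def using \<theta> b(1) eb
      by (intro mult_nonneg_nonneg divide_nonneg_nonneg) linarith+
    ultimately have w: "0 \<le> w" "w \<le> 1" by simp_all
    define x where "x = ln (1 - \<theta>)"
    have x: "exp x = 1 - \<theta>" "x < 0" using \<theta> by (auto simp: x_def)
    let ?\<mu> = "mix (1 - w) (return borel x) (uniform_law 0 b)"
    have U: "real_distribution (uniform_law 0 b)" using b(1) by (rule real_distribution_uniform_law)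
    have \<mu>: "real_distribution ?\<mu>" using w U by (intro real_distribution_mix real_distribution_return) auto
    have wE: "w * ((exp b - exp 0) / (b - 0)) = \<theta>" using b(1) eb by (simp add: w_def)
    have "(\<integral>\<^sup>+ y. ennreal (exp y) \<partial>?\<mu>) = ennreal ((1 - w) * exp x + w * ((exp b - exp 0) / (b - 0)))"
      using w b(1) by (subst nn_integral_mix) (simp_all add: U real_distribution_return nn_integral_return nn_integral_exp_uniform_law
          ennreal_mult'[symmetric] del: times_divide_eq_right flip: ennreal_plus)
    also have "\<dots> \<le> ennreal 1"
    proof (rule ennreal_leI)
      have "(1 - w) * exp x \<le> 1 * (1 - \<theta>)" unfolding x(1) using w \<theta> by (intro mult_right_mono) auto
      then show "(1 - w) * exp x + w * ((exp b - exp 0) / (b - 0)) \<le> 1" unfolding wE by simp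
    qed
    finally have int: "(\<integral>\<^sup>+ y. ennreal (exp y) \<partial>?\<mu>) \<le> 1" by simp
    have "atom_plus_density {0..} 0 0 (\<lambda>y. (1 - (1 - w)) * (indicator {0..b} y / (b - 0))) ?\<mu>"
      using x w b by (intro atom_plus_density_away_from_atom[OF atom_plus_density_mix_uniform]) auto
    moreover have "antimono_on {0<..} (\<lambda>y. (1 - (1 - w)) * (indicator {0..b} y / (b - 0)))"
      using w b by (intro monotone_onI) (auto split: split_indicator)
    ultimately have "decreasing_law_from 0 ?\<mu>" unfolding decreasing_law_from_def by blast
    then have "?\<mu> \<in> log_laws (decreasing_law_from 0)"
      unfolding log_laws_def using \<mu> int by simp
    then have "measure ?\<mu> {L..} \<le> tail_sup (decreasing_law_from 0) L" by (rule tail_sup_upper)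
    moreover have "measure ?\<mu> {L..} = \<theta> * c"
    proof -
      have "measure ?\<mu> {L..} = w * ((b - L) / (b - 0))"
        using w b x L U by (subst measure_mix) (auto simp: real_distribution_return measure_return measure_uniform_law_tail)
      also have "\<dots> = \<theta> * ((1 - c) / (exp b - 1))" unfolding b(3) w_def using b(1) by simp
      also have "(1 - c) / (exp b - 1) = c" unfolding b(2) using c c1 by (simp add: field_simps)
      finally show ?thesis .
    qed
    ultimately show "\<theta> * c \<le> tail_sup (decreasing_law_from 0) L" by simp
  qed
  then show ?thesis by (simp add: c_def)
qed

lemma decreasing_law_from_return: "decreasing_law_from x (return borel x)"
  unfolding decreasing_law_from_def using atom_plus_density_subset[OF atom_plus_density_return[of x]]
  by (intro exI conjI) (auto intro!: monotone_onI)

lemma tail_sup_decreasing_from_0: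
  assumes "0 \<le> L" "is_t (exp (- L)) t"
  shows "tail_sup (decreasing_law_from 0) L = exp (- L) / t"
proof -
  have eq: "exp (- L) / t = 1 - ln t" using assms(2) by (auto simp: is_t_def field_simps)
  show ?thesis
  proof (cases "L = 0")
    case True
    then have "t = 1" using assms(2) is_t_1_1 t_exists_unique[of 1] by auto
    then show ?thesis using True tail_sup_0[of "decreasing_law_from 0"] decreasing_law_from_return by simp
  next
    case False
    then have L: "0 < L" using assms by simp
    show ?thesis unfolding eq
    proof (rule antisym)
      show "tail_sup (decreasing_law_from 0) L \<le> 1 - ln t"
        using decreasing_from_0_tail_le[OF _ L assms(2)] return_0_in_log_laws[of "decreasing_law_from 0"] decreasing_law_from_return
        by (intro tail_sup_least) auto
      show "1 - ln t \<le> tail_sup (decreasing_law_from 0) L" by (rule decreasing_from_0_tail_sup_ge[OF L assms(2)])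
    qed
  qed
qed

section \<open>Reduction to uniform laws\<close>

text \<open>The uniform law on \<open>[a, b]\<close> has exponential moment \<open>(e\<^sup>b - e\<^sup>a) / (b - a)\<close>; so \<open>q\<close> is the tail beyond
  \<open>L\<close> of a uniform law whose exponential moment is at most \<open>1\<close>.\<close>
definition unit_uniform_tail :: "real \<Rightarrow> real \<Rightarrow> bool" where
  "unit_uniform_tail L q \<longleftrightarrow> (\<exists>a b. a < b \<and> a \<le> L \<and> L \<le> b \<and> exp b - exp a \<le> b - a \<and> q = (b - L) / (b - a))"

text \<open>Each point outside the support has an open null neighbourhood, and by the Lindelof
  property countably many of these suffice.\<close>
lemma emeasure_below_support:
  assumes \<mu>: "real_distribution \<mu>" and bdd: "bdd_below (law_support \<mu>)"
  shows "emeasure \<mu> {..<Inf (law_support \<mu>)} = 0"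
proof -
  interpret real_distribution \<mu> by (rule \<mu>)
  let ?a = "Inf (law_support \<mu>)"
  define \<F> where "\<F> = {U::real set. open U \<and> emeasure \<mu> U = 0}"
  obtain \<F>' where F': "\<F>' \<subseteq> \<F>" "countable \<F>'" "\<Union>\<F>' = \<Union>\<F>"
    using Lindelof[of \<F>] by (auto simp: \<F>_def)
  have null: "emeasure \<mu> U = 0" "U \<in> sets \<mu>" if "U \<in> \<F>'" for U using F'(1) that by (auto simp: \<F>_def)
  have "(\<Union>U\<in>\<F>'. U) \<in> null_sets \<mu>"
    using F'(2) null by (intro null_sets_UN') (auto intro: null_setsI)
  moreover have "{..<?a} \<subseteq> (\<Union>U\<in>\<F>'. U)"
  proof
    fix y assume "y \<in> {..<?a}"
    then have "y \<notin> law_support \<mu>" using bdd cInf_lower[of y] by force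
    then obtain U where "open U" "y \<in> U" "emeasure \<mu> U = 0"
      unfolding law_support_def by auto
    then have "y \<in> \<Union>\<F>" by (auto simp: \<F>_def)
    then show "y \<in> (\<Union>U\<in>\<F>'. U)" using F'(3) by simp
  qed
  ultimately show ?thesis using null_sets_subset[of "\<Union>U\<in>\<F>'. U" \<mu> "{..<?a}"] by (auto simp: null_sets_def)
qed

text \<open>The graph of \<open>exp\<close> lies above its tangent at \<open>y\<close>.\<close>
lemma exp_secant: "exp y - exp x \<le> exp y * (y - x)" for x y :: real
proof -
  have "1 + (x - y) \<le> exp (x - y)" by (rule exp_ge_add_one_self)
  then have "exp y * (1 + (x - y)) \<le> exp y * exp (x - y)" by (intro mult_left_mono) auto
  then show ?thesis by (simp add: exp_diff algebra_simps)
qed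

text \<open>
  Flattening with \<open>k y = e\<^sup>y - e\<^sup>a\<close> shows that one may put density \<open>v\<close> on \<open>[a, b]\<close> and the
  remaining mass \<open>1 - v (b - a)\<close> at \<open>a\<close>, without increasing the exponential moment.
  Spreading this mass with density \<open>v\<close> to the left of \<open>a\<close> decreases the moment further and leads to
  the uniform law on \<open>[b - 1 / v, b]\<close>, with the same tail beyond \<open>L\<close>.
\<close>
lemma decreasing_on_support_tail_uniform:
  assumes \<mu>: "\<mu> \<in> log_laws decreasing_law_on_support" and L: "0 < L" and pos: "0 < measure \<mu> {L..}"
  shows "unit_uniform_tail L (measure \<mu> {L..})"
proof -
  define q where "q = measure \<mu> {L..}"
  have q: "0 < q" using pos by (simp add: q_def)
  have rd: "real_distribution \<mu>" and int: "(\<integral>\<^sup>+ x. ennreal (exp x) \<partial>\<mu>) \<le> 1"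
    using \<mu> by (auto simp: log_laws_def)
  interpret real_distribution \<mu> by (rule rd)
  obtain a p f where a: "bdd_below (law_support \<mu>)" "a = Inf (law_support \<mu>)"
    and f: "atom_plus_density UNIV a p f \<mu>" "antimono_on {a<..} f"
    using \<mu> unfolding log_laws_def decreasing_law_on_support_def by auto
  have null: "emeasure \<mu> {..<a} = 0" using emeasure_below_support[OF rd a(1)] a(2) by simp
  have full: "emeasure \<mu> {a..} = 1"
  proof -
    have "emeasure \<mu> {..<a} + emeasure \<mu> {a..} = emeasure \<mu> ({..<a} \<union> {a..})"
      by (intro plus_emeasure) auto
    also have "{..<a} \<union> {a..} = space \<mu>" by (auto simp: space_eq_univ)
    finally show ?thesis using null emeasure_space_1 by simp
  qed
  have base: "ennreal (exp a) = (\<integral>\<^sup>+ y. ennreal (exp a) * indicator {a..} y \<partial>\<mu>)"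
    using full by (simp add: nn_integral_cmult_indicator)
  have aL: "a < L"
  proof -
    have "ennreal (exp a) \<le> (\<integral>\<^sup>+ y. ennreal (exp y) \<partial>\<mu>)"
      by (subst base, intro nn_integral_mono) (auto split: split_indicator)
    also have "\<dots> \<le> ennreal 1" using int by simp
    finally have "exp a \<le> 1" by (subst (asm) ennreal_le_iff) auto
    then show ?thesis using L by simp
  qed
  have dens: "has_decreasing_density_beyond a f \<mu>"
    using f rd by (intro has_decreasing_density_beyondI) auto
  note ctx = rd dens aL q_def q
  define v where "v = f L"
  have v: "0 < v" unfolding v_def by (rule density_at_threshold_pos[OF ctx])
  define b where "b = L + q / v"
  have bL: "L < b" using v q by (simp add: b_def)
  have mass: "v * (b - a) \<le> 1"
    unfolding v_def b_def by (rule order_trans[OF flattened_mass_le[OF ctx] prob_le_1])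
  have "ennreal (exp a + v * ((exp b - exp a * b) - (exp a - exp a * a)))
      = ennreal (exp a) + ennreal v * (\<integral>\<^sup>+ y. ennreal (exp y - exp a) * indicator {a..b} y \<partial>lborel)"
  proof -
    have "(\<integral>\<^sup>+ y. ennreal (exp y - exp a) * indicator {a..b} y \<partial>lborel) = ennreal ((exp b - exp a * b) - (exp a - exp a * a))"
      using bL aL by (intro nn_integral_FTC_Icc[where F = "\<lambda>y. exp y - exp a * y"]) (auto intro!: derivative_eq_intros)
    moreover have "0 \<le> (exp b - exp a * b) - (exp a - exp a * a)"
      using exp_secant[of a b] exp_ge_add_one_self[of "b - a"] mult_left_mono[of "1 + (b - a)" "exp (b - a)" "exp a"]
      by (simp add: exp_diff algebra_simps)
    moreover have "ennreal (exp a + v * Z) = ennreal (exp a) + ennreal v * ennreal Z" if "0 \<le> Z" for Z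
      using v that by (subst ennreal_plus) (auto simp: ennreal_mult')
    ultimately show ?thesis by simp
  qed
  also have "\<dots> \<le> ennreal (exp a) + (\<integral>\<^sup>+ y. ennreal (exp y - exp a) * indicator {a<..} y \<partial>\<mu>)"
    unfolding v_def b_def by (intro add_left_mono flatten_density[OF ctx]) (auto intro!: monotone_onI)
  also have "\<dots> = (\<integral>\<^sup>+ y. ennreal (exp a) * indicator {a..} y + ennreal (exp y - exp a) * indicator {a<..} y \<partial>\<mu>)"
    by (subst base, intro nn_integral_add[symmetric]) auto
  also have "\<dots> \<le> (\<integral>\<^sup>+ y. ennreal (exp y) \<partial>\<mu>)"
    by (intro nn_integral_mono) (auto split: split_indicator simp flip: ennreal_plus)
  also have "\<dots> \<le> ennreal 1" using int by simp
  finally have E: "exp a + v * ((exp b - exp a * b) - (exp a - exp a * a)) \<le> 1"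
    by (subst (asm) ennreal_le_iff) auto
  define a' where "a' = b - 1 / v"
  have ba': "b - a' = 1 / v" by (simp add: a'_def)
  have "v * (exp b - exp a') \<le> 1"
  proof -
    have "v * (exp b - exp a') = v * (exp a - exp a') + v * (exp b - exp a)" by (simp add: algebra_simps)
    also have "\<dots> \<le> v * (exp a * (a - a')) + v * (exp b - exp a)"
      using v exp_secant[of a a'] by (intro add_right_mono mult_left_mono) auto
    also have "v * (exp a * (a - a')) = exp a * (1 - v * (b - a))" using v by (simp add: a'_def field_simps)
    finally show ?thesis using E by (simp add: algebra_simps)
  qed
  then have "exp b - exp a' \<le> b - a'" unfolding ba' using v by (simp add: field_simps)
  moreover have "q = (b - L) / (b - a')" unfolding ba' using v by (simp add: b_def)
  moreover have "a' < b" using v by (simp add: a'_def)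
  moreover have "a' \<le> L"
  proof -
    have "q \<le> 1" by (simp add: q_def)
    then have "q / v \<le> 1 / v" using v by (intro divide_right_mono) auto
    then show ?thesis by (simp add: a'_def b_def)
  qed
  ultimately show ?thesis using bL unfolding unit_uniform_tail_def q_def by (intro exI[of _ a'] exI[of _ b]) auto
qed

text \<open>The mode \<open>x\<close> need not be the centre of symmetry \<open>c / 2\<close>, since a density can be constant around
  its mode. If \<open>x\<close> lies to the right of the centre, the mirror image of the increasing branch
  of \<open>f\<close> serves as the density.\<close>
lemma unimodal_symmetric_density:
  assumes \<mu>: "real_distribution \<mu>" and uni: "unimodal_law \<mu>" and sym: "distr \<mu> borel (\<lambda>y. c - y) = \<mu>"
  shows "\<exists>f. has_decreasing_density_beyond (c / 2) f \<mu>"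
proof -
  obtain x p f where f: "atom_plus_density UNIV x p f \<mu>" "mono_on {..<x} f" "antimono_on {x<..} f"
    using uni unfolding unimodal_law_def by auto
  have fm[measurable]: "f \<in> borel_measurable borel" and f0: "\<And>y. 0 \<le> f y"
    using f(1) by (auto simp: atom_plus_density_def)
  show ?thesis
  proof (cases "x \<le> c / 2")
    case True
    then have "has_decreasing_density_beyond (c / 2) f \<mu>"
      using f \<mu> by (intro has_decreasing_density_beyondI[of UNIV x p]) (auto intro: monotone_on_subset)
    then show ?thesis by blast
  next
    case False
    define g where "g y = f (c - y)" for y
    have gm[measurable]: "g \<in> borel_measurable borel" unfolding g_def by measurable
    have "antimono_on {c / 2<..} g"
    proof (rule monotone_onI)
      fix y z assume "y \<in> {c / 2<..}" "z \<in> {c / 2<..}" "y \<le> z"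
      then have "f (c - z) \<le> f (c - y)" using False by (intro mono_onD[OF f(2)]) auto
      then show "g z \<le> g y" by (simp add: g_def)
    qed
    moreover have "(\<integral>\<^sup>+ y. h y * indicator {c / 2<..} y \<partial>\<mu>) = (\<integral>\<^sup>+ y. h y * (ennreal (g y) * indicator {c / 2<..} y) \<partial>lborel)"
      if h[measurable]: "h \<in> borel_measurable borel" for h :: "real \<Rightarrow> ennreal"
    proof -
      have "(\<integral>\<^sup>+ y. h y * indicator {c / 2<..} y \<partial>\<mu>) = (\<integral>\<^sup>+ y. h (c - y) * indicator {c / 2<..} (c - y) \<partial>\<mu>)"
        by (rule nn_integral_reflect[OF sym \<mu>, symmetric]) measurable
      also have "\<dots> = (\<integral>\<^sup>+ y. h (c - y) * indicator {..<c / 2} y \<partial>\<mu>)"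
        by (intro nn_integral_cong) (auto split: split_indicator)
      also have "\<dots> = (\<integral>\<^sup>+ y. h (c - y) * (ennreal (f y) * indicator {..<c / 2} y) \<partial>lborel)"
        using False by (intro nn_integral_on_density_part[OF f(1) _ _ _ \<mu>]) auto
      also have "\<dots> = (\<integral>\<^sup>+ y. h (c - (c + (-1) * y)) * (ennreal (f (c + (-1) * y)) * indicator {..<c / 2} (c + (-1) * y)) \<partial>lborel)"
        by (subst nn_integral_real_affine[where c = "-1" and t = c]) auto
      also have "\<dots> = (\<integral>\<^sup>+ y. h y * (ennreal (g y) * indicator {c / 2<..} y) \<partial>lborel)"
        by (intro nn_integral_cong) (auto split: split_indicator simp: g_def)
      finally show ?thesis .
    qed
    ultimately have "has_decreasing_density_beyond (c / 2) g \<mu>"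
      unfolding has_decreasing_density_beyond_def using f0 by (auto simp: g_def)
    then show ?thesis by blast
  qed
qed

text \<open>
  By symmetry the exponential moment is \<open>e\<^sup>m \<integral> cosh (y - m) d\<mu>\<close>, where \<open>m\<close> is the centre. Each half-line
  is flattened with the function \<open>k y = cosh (y - m) - 1\<close>, which is increasing to the right of
  \<open>m\<close> and vanishes at \<open>m\<close>. So one may put density \<open>v\<close> on \<open>[2 m - b, b]\<close> and the remaining mass at
  \<open>m\<close>. Moving that mass to the left of \<open>2 m - b\<close>, with density \<open>v\<close>, yields the uniform law on \<open>[b - 1 / v, b]\<close>.
\<close>
lemma unimodal_symmetric_tail_uniform:
  assumes \<mu>: "\<mu> \<in> log_laws (\<lambda>\<mu>. unimodal_law \<mu> \<and> symmetric_law \<mu>)" and L: "0 < L" and pos: "0 < measure \<mu> {L..}"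
  shows "unit_uniform_tail L (measure \<mu> {L..})"
proof -
  define q where "q = measure \<mu> {L..}"
  have q: "0 < q" using pos by (simp add: q_def)
  have rd: "real_distribution \<mu>" and int: "(\<integral>\<^sup>+ x. ennreal (exp x) \<partial>\<mu>) \<le> 1"
    using \<mu> by (auto simp: log_laws_def)
  interpret real_distribution \<mu> by (rule rd)
  obtain c where sym: "distr \<mu> borel (\<lambda>y. c - y) = \<mu>"
    using \<mu> unfolding log_laws_def symmetric_law_def by auto
  define m where "m = c / 2"
  have c: "c = 2 * m" by (simp add: m_def)
  obtain f where dens: "has_decreasing_density_beyond m f \<mu>"
    using unimodal_symmetric_density[OF rd _ sym] \<mu> unfolding log_laws_def m_def by auto
  have mL: "m < L" using symmetric_centre_le_0[OF sym rd int] L by (simp add: m_def)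
  note ctx = rd dens mL q_def q
  define v where "v = f L"
  have v: "0 < v" unfolding v_def by (rule density_at_threshold_pos[OF ctx])
  define b where "b = L + q / v"
  have bL: "L < b" using v q by (simp add: b_def)
  have half: "prob {m<..} \<le> 1 / 2"
  proof -
    have "{y. c - y \<in> {m<..}} = {..<m}" by (auto simp: c)
    then have "prob {..<m} = prob {m<..}" using measure_reflect[OF sym rd, of "{m<..}"] by simp
    moreover have "prob ({..<m} \<union> {m<..}) = prob {..<m} + prob {m<..}"
      by (intro finite_measure_Union) auto
    ultimately show ?thesis using prob_le_1[of "{..<m} \<union> {m<..}"] by linarith
  qed
  have mass: "2 * (v * (b - m)) \<le> 1"
    using order_trans[OF flattened_mass_le[OF ctx] half] unfolding v_def b_def by linarith
  define k where "k y = cosh (y - m) - 1" for y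
  have k0: "0 \<le> k y" for y by (simp add: k_def cosh_real_ge_1)
  have k_meas[measurable]: "k \<in> borel_measurable borel"
    unfolding k_def by (intro borel_measurable_continuous_onI continuous_intros)
  have ksym: "k (c - y) = k y" for y
  proof -
    have "cosh (c - y - m) = cosh (- (y - m))" by (simp add: c)
    then show ?thesis by (simp add: k_def)
  qed
  have kexp: "exp y + exp (c - y) = 2 * exp m + 2 * exp m * k y" for y
  proof -
    have e: "exp m * exp (y - m) = exp y" "exp m * exp (m - y) = exp (c - y)"
      by (simp_all add: mult_exp_exp c)
    have "2 * exp m + 2 * exp m * k y = exp m * exp (y - m) + exp m * exp (m - y)"
      by (simp add: k_def cosh_field_def algebra_simps)
    then show ?thesis using e by simp
  qed
  define J where "J = (\<integral>\<^sup>+ y. ennreal (k y) * indicator {m<..} y \<partial>\<mu>)"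
  define F where "F = v * ((sinh (b - m) - b) - (sinh (m - m) - m))"
  have FJ: "ennreal F \<le> J" and F0: "0 \<le> F"
  proof -
    have "(\<integral>\<^sup>+ y. ennreal (k y) * indicator {m..b} y \<partial>lborel) = ennreal ((sinh (b - m) - b) - (sinh (m - m) - m))"
      using bL mL k0 by (intro nn_integral_FTC_Icc[where F = "\<lambda>y. sinh (y - m) - y"] k_meas) (auto intro!: derivative_eq_intros simp: k_def)
    then have "ennreal F = ennreal v * (\<integral>\<^sup>+ y. ennreal (k y) * indicator {m..b} y \<partial>lborel)"
      using v by (simp add: F_def ennreal_mult')
    also have "\<dots> \<le> J" unfolding J_def v_def b_def
    proof (rule flatten_density[OF ctx])
      show "mono_on {m<..} k"
        by (auto intro!: monotone_onI simp: k_def cosh_real_nonneg_le_iff)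
    qed (use k0 in auto)
    finally show "ennreal F \<le> J" .
    have "b - m \<le> sinh (b - m)" using real_le_x_sinh[of "b - m"] bL mL
      by (simp only: sinh_field_def exp_minus[symmetric])
    then show "0 \<le> F" using v by (simp add: F_def)
  qed
  have "ennreal (2 * exp m + 2 * exp m * (2 * F)) \<le> ennreal (2 * exp m) + ennreal (2 * exp m) * (J + J)"
  proof -
    have "ennreal (2 * exp m + 2 * exp m * (2 * F)) = ennreal (2 * exp m) + ennreal (2 * exp m) * (ennreal F + ennreal F)"
    proof -
      have "ennreal (2 * exp m + 2 * exp m * (F + F)) = ennreal (2 * exp m) + ennreal (2 * exp m * (F + F))"
        using F0 by (intro ennreal_plus) auto
      also have "ennreal (2 * exp m * (F + F)) = ennreal (2 * exp m) * ennreal (F + F)"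
        by (intro ennreal_mult') auto
      also have "ennreal (F + F) = ennreal F + ennreal F" using F0 by (intro ennreal_plus)
      finally show ?thesis by (simp only: mult_2)
    qed
    also have "\<dots> \<le> ennreal (2 * exp m) + ennreal (2 * exp m) * (J + J)"
      using FJ by (intro add_left_mono mult_left_mono add_mono) auto
    finally show ?thesis .
  qed
  also have "\<dots> = (\<integral>\<^sup>+ y. ennreal (2 * exp m) + ennreal (2 * exp m) * (ennreal (k y) * indicator {m<..} y + ennreal (k (c - y)) * indicator {m<..} (c - y)) \<partial>\<mu>)"
  proof -
    have "J = (\<integral>\<^sup>+ y. ennreal (k (c - y)) * indicator {m<..} (c - y) \<partial>\<mu>)"
      unfolding J_def by (rule nn_integral_reflect[OF sym rd, symmetric]) measurable
    then have "J + J = (\<integral>\<^sup>+ y. ennreal (k y) * indicator {m<..} y + ennreal (k (c - y)) * indicator {m<..} (c - y) \<partial>\<mu>)"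
      by (subst nn_integral_add) (auto simp: J_def)
    moreover have "ennreal (2 * exp m) = (\<integral>\<^sup>+ y. ennreal (2 * exp m) \<partial>\<mu>)" using emeasure_space_1 by simp
    ultimately show ?thesis by (simp add: nn_integral_add nn_integral_cmult)
  qed
  also have "\<dots> \<le> (\<integral>\<^sup>+ y. ennreal (exp y) + ennreal (exp (c - y)) \<partial>\<mu>)"
  proof (intro nn_integral_mono)
    fix y
    have "ennreal (k y) * indicator {m<..} y + ennreal (k (c - y)) * indicator {m<..} (c - y) \<le> ennreal (k y)"
      unfolding ksym by (auto split: split_indicator simp: c)
    then have "ennreal (2 * exp m) + ennreal (2 * exp m) * (ennreal (k y) * indicator {m<..} y + ennreal (k (c - y)) * indicator {m<..} (c - y))
        \<le> ennreal (2 * exp m) + ennreal (2 * exp m) * ennreal (k y)" by (intro add_left_mono mult_left_mono) auto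
    also have "\<dots> = ennreal (exp y + exp (c - y))" unfolding kexp using k0[of y] by (simp add: ennreal_mult')
    finally show "ennreal (2 * exp m) + ennreal (2 * exp m) * (ennreal (k y) * indicator {m<..} y + ennreal (k (c - y)) * indicator {m<..} (c - y))
        \<le> ennreal (exp y) + ennreal (exp (c - y))" by simp
  qed
  also have "\<dots> = (\<integral>\<^sup>+ y. ennreal (exp y) \<partial>\<mu>) + (\<integral>\<^sup>+ y. ennreal (exp (c - y)) \<partial>\<mu>)"
    by (intro nn_integral_add) auto
  also have "(\<integral>\<^sup>+ y. ennreal (exp (c - y)) \<partial>\<mu>) = (\<integral>\<^sup>+ y. ennreal (exp y) \<partial>\<mu>)"
    using sym rd by (rule nn_integral_reflect) measurable
  also have "(\<integral>\<^sup>+ y. ennreal (exp y) \<partial>\<mu>) + (\<integral>\<^sup>+ y. ennreal (exp y) \<partial>\<mu>) \<le> 1 + 1"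
    using int by (intro add_mono)
  finally have "ennreal (2 * exp m + 2 * exp m * (2 * F)) \<le> ennreal 2" by simp
  then have E: "exp m + exp m * (2 * F) \<le> 1" by (subst (asm) ennreal_le_iff) auto
  have expF: "exp m * (2 * F) = v * (exp b - exp (2 * m - b)) - 2 * (v * (b - m)) * exp m"
  proof -
    have e: "exp m * exp (b - m) = exp b" "exp m * exp (m - b) = exp (2 * m - b)"
      by (simp_all add: mult_exp_exp)
    have "exp m * (2 * F) = v * (exp m * exp (b - m) - exp m * exp (m - b)) - 2 * (v * (b - m)) * exp m"
      by (simp add: F_def sinh_field_def field_simps)
    then show ?thesis using e by simp
  qed
  define a' where "a' = b - 1 / v"
  have ba': "b - a' = 1 / v" by (simp add: a'_def)
  have va': "v * (2 * m - b - a') = 1 - 2 * (v * (b - m))" using v by (simp add: a'_def field_simps)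
  have "0 \<le> v * (2 * m - b - a')" using mass va' by simp
  then have a'le: "0 \<le> 2 * m - b - a'" using v by (simp add: zero_le_mult_iff)
  have "v * (exp b - exp a') \<le> 1"
  proof -
    have "exp (2 * m - b) - exp a' \<le> exp (2 * m - b) * (2 * m - b - a')"
      using exp_secant[of "2 * m - b" a'] by simp
    also have "\<dots> \<le> exp m * (2 * m - b - a')" using a'le bL mL by (intro mult_right_mono) auto
    finally have s: "exp (2 * m - b) - exp a' \<le> exp m * (2 * m - b - a')" .
    have "v * (exp b - exp a') = v * (exp (2 * m - b) - exp a') + v * (exp b - exp (2 * m - b))" by (simp add: algebra_simps)
    also have "\<dots> \<le> v * (exp m * (2 * m - b - a')) + v * (exp b - exp (2 * m - b))"
      using v s by (intro add_right_mono mult_left_mono) auto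
    also have "v * (exp m * (2 * m - b - a')) = exp m * (1 - 2 * (v * (b - m)))" using va' by (simp add: mult.left_commute)
    finally show ?thesis using E expF by (simp add: algebra_simps)
  qed
  then have "exp b - exp a' \<le> b - a'" unfolding ba' using v by (simp add: field_simps)
  moreover have "q = (b - L) / (b - a')" unfolding ba' using v by (simp add: b_def)
  moreover have "a' < b" using v by (simp add: a'_def)
  moreover have "a' \<le> L"
  proof -
    have "q \<le> 1" by (simp add: q_def)
    then have "q / v \<le> 1 / v" using v by (intro divide_right_mono) auto
    then show ?thesis by (simp add: a'_def b_def)
  qed
  ultimately show ?thesis using bL unfolding unit_uniform_tail_def q_def by (intro exI[of _ a'] exI[of _ b]) auto
qed

section \<open>Log-laws with decreasing density, and unimodal symmetric log-laws\<close>

lemma uniform_symmetric: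
  assumes "a < b"
  shows "distr (uniform_law a b) borel (\<lambda>y. (a + b) - y) = uniform_law a b"
proof (rule measure_eqI)
  interpret real_distribution "uniform_law a b" using assms by (rule real_distribution_uniform_law)
  fix A assume "A \<in> sets (distr (uniform_law a b) borel (\<lambda>y. (a + b) - y))"
  then have A[measurable]: "A \<in> sets borel" by simp
  have "emeasure (distr (uniform_law a b) borel (\<lambda>y. (a + b) - y)) A = (\<integral>\<^sup>+ y. indicator A y \<partial>distr (uniform_law a b) borel (\<lambda>y. (a + b) - y))"
    by simp
  also have "\<dots> = (\<integral>\<^sup>+ y. indicator A (a + b - y) \<partial>uniform_law a b)"
    by (intro nn_integral_distr) auto
  also have "\<dots> = ennreal (1 / (b - a)) * (\<integral>\<^sup>+ y. indicator A (a + b - y) * indicator {a..b} y \<partial>lborel)"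
    using assms by (intro nn_integral_uniform_law) auto
  also have "(\<integral>\<^sup>+ y. indicator A (a + b - y) * indicator {a..b} y \<partial>lborel)
      = (\<integral>\<^sup>+ y. indicator A (a + b - ((a + b) + (-1) * y)) * indicator {a..b} ((a + b) + (-1) * y) \<partial>lborel)"
    by (subst nn_integral_real_affine[where c = "-1" and t = "a + b"]) auto
  also have "\<dots> = (\<integral>\<^sup>+ y. indicator A y * indicator {a..b} y \<partial>lborel)"
    by (intro nn_integral_cong) (auto split: split_indicator)
  also have "ennreal (1 / (b - a)) * \<dots> = (\<integral>\<^sup>+ y. indicator A y \<partial>uniform_law a b)"
    using assms by (intro nn_integral_uniform_law[symmetric]) auto
  also have "\<dots> = emeasure (uniform_law a b) A" by simp
  finally show "emeasure (distr (uniform_law a b) borel (\<lambda>y. (a + b) - y)) A = emeasure (uniform_law a b) A" .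
qed (simp add: uniform_law_def)

lemma uniform_unimodal_symmetric:
  assumes "a < b"
  shows "unimodal_law (uniform_law a b) \<and> symmetric_law (uniform_law a b)"
proof
  have "mono_on {..<b} (\<lambda>y. indicator {a..b} y / (b - a))"
    using assms by (intro mono_onI divide_right_mono) (auto split: split_indicator)
  moreover have "antimono_on {b<..} (\<lambda>y. indicator {a..b} y / (b - a))"
    by (intro monotone_onI) (auto split: split_indicator)
  ultimately show "unimodal_law (uniform_law a b)"
    unfolding unimodal_law_def using atom_plus_density_uniform_law[OF assms] by blast
  show "symmetric_law (uniform_law a b)"
    unfolding symmetric_law_def using uniform_symmetric[OF assms] by blast
qed

lemma law_support_uniform:
  assumes "a < b"
  shows "law_support (uniform_law a b) = {a..b}"
proof (intro equalityI subsetI)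
  fix y assume y: "y \<in> law_support (uniform_law a b)"
  show "y \<in> {a..b}"
  proof (rule ccontr)
    assume "y \<notin> {a..b}"
    then have "y \<in> - {a..b}" "open (- {a..b})" by auto
    then have "0 < emeasure (uniform_law a b) (- {a..b})"
      using y unfolding law_support_def by blast
    then show False using assms by (simp add: emeasure_uniform_law)
  qed
next
  fix y assume y: "y \<in> {a..b}"
  show "y \<in> law_support (uniform_law a b)"
    unfolding law_support_def
  proof (intro CollectI allI impI)
    fix U :: "real set" assume U: "open U \<and> y \<in> U"
    then obtain e where e: "0 < e" "ball y e \<subseteq> U" using open_contains_ball by blast
    define l where "l = max a (y - e / 2)"
    define u where "u = min b (y + e / 2)"
    have lu: "l < u" using y e assms by (auto simp: l_def u_def)
    have "{l..u} \<subseteq> U \<inter> {a..b}"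
      using e by (auto simp: l_def u_def dist_real_def intro!: subsetD[OF e(2)])
    moreover have "U \<inter> {a..b} \<in> sets lborel" using U by auto
    ultimately have "emeasure lborel {l..u} \<le> emeasure lborel (U \<inter> {a..b})" by (rule emeasure_mono)
    then have "0 < emeasure lborel (U \<inter> {a..b})" using lu by (auto simp: zero_less_iff_neq_zero)
    then show "0 < emeasure (uniform_law a b) U"
      using assms U by (simp add: emeasure_uniform_law ennreal_zero_less_mult_iff)
  qed
qed

lemma uniform_decreasing_on_support:
  assumes "a < b"
  shows "decreasing_law_on_support (uniform_law a b)"
proof -
  have "antimono_on {a<..} (\<lambda>y. indicator {a..b} y / (b - a))"
    using assms by (intro monotone_onI) (auto split: split_indicator)
  moreover have "Inf (law_support (uniform_law a b)) = a" "bdd_below (law_support (uniform_law a b))"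
    using assms by (simp_all add: law_support_uniform cInf_atLeastAtMost)
  ultimately show ?thesis
    unfolding decreasing_law_on_support_def using atom_plus_density_uniform_law[OF assms, of a] by metis
qed

lemma return_decreasing_on_support: "decreasing_law_on_support (return borel x)"
proof -
  have "law_support (return borel x) = {x}"
  proof (intro equalityI subsetI)
    fix y assume y: "y \<in> law_support (return borel x)"
    show "y \<in> {x}"
    proof (rule ccontr)
      assume "y \<notin> {x}"
      then have "0 < emeasure (return borel x) (- {x})" using y unfolding law_support_def by blast
      then show False by (simp add: emeasure_return)
    qed
  next
    fix y assume "y \<in> {x}"
    then show "y \<in> law_support (return borel x)"
      unfolding law_support_def by (auto simp: emeasure_return)
  qed
  then show ?thesis
    unfolding decreasing_law_on_support_def using atom_plus_density_return[of x]
    by (intro exI[of _ x] exI[of _ 1] exI[of _ "\<lambda>_. 0"]) (auto intro!: monotone_onI)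
qed

lemma return_symmetric: "symmetric_law (return borel x)"
  unfolding symmetric_law_def by (intro exI[of _ "2 * x"]) (auto simp: distr_return)

lemma unit_uniform_tail_le_tail_sup:
  assumes "unit_uniform_tail L q" "\<And>a b. a < b \<Longrightarrow> P (uniform_law a b)"
  shows "q \<le> tail_sup P L"
proof -
  obtain a b where ab: "a < b" "a \<le> L" "L \<le> b" "exp b - exp a \<le> b - a" "q = (b - L) / (b - a)"
    using assms(1) unfolding unit_uniform_tail_def by blast
  then have "uniform_law a b \<in> log_laws P" by (intro uniform_in_log_laws assms(2))
  from tail_sup_upper[OF this, of L] show ?thesis using ab by (simp add: measure_uniform_law_tail)
qed

lemma tail_sup_nonneg:
  assumes "P (return borel 0)"
  shows "0 \<le> tail_sup P L"
  using tail_sup_upper[OF return_0_in_log_laws[of P, OF assms], of L] measure_nonneg order_trans by blast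

lemma tail_sup_le_of_unit_uniform:
  assumes "P (return borel 0)" "0 \<le> C" "\<And>q. unit_uniform_tail L q \<Longrightarrow> q \<le> C"
    "\<And>\<mu>. \<mu> \<in> log_laws P \<Longrightarrow> 0 < measure \<mu> {L..} \<Longrightarrow> unit_uniform_tail L (measure \<mu> {L..})"
  shows "tail_sup P L \<le> C"
proof (rule tail_sup_least)
  show "log_laws P \<noteq> {}" using return_0_in_log_laws[of P, OF assms(1)] by auto
  fix \<mu> assume \<mu>: "\<mu> \<in> log_laws P"
  show "measure \<mu> {L..} \<le> C"
  proof (cases "0 < measure \<mu> {L..}")
    case True
    then show ?thesis using assms(3,4) \<mu> by blast
  next
    case False
    then show ?thesis using assms(2) by simp
  qed
qed

lemma tail_sup_decreasing_eq_unimodal_symmetric: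
  assumes "0 \<le> L"
  shows "tail_sup decreasing_law_on_support L = tail_sup (\<lambda>\<mu>. unimodal_law \<mu> \<and> symmetric_law \<mu>) L"
proof (cases "L = 0")
  case True
  then show ?thesis
    using tail_sup_0[of decreasing_law_on_support] tail_sup_0[of "\<lambda>\<mu>. unimodal_law \<mu> \<and> symmetric_law \<mu>"]
      return_decreasing_on_support unimodal_return return_symmetric by simp
next
  case False
  then have L: "0 < L" using assms by simp
  show ?thesis
  proof (rule antisym)
    show "tail_sup decreasing_law_on_support L \<le> tail_sup (\<lambda>\<mu>. unimodal_law \<mu> \<and> symmetric_law \<mu>) L"
      by (rule tail_sup_le_of_unit_uniform)
         (auto intro: return_decreasing_on_support tail_sup_nonneg unimodal_return return_symmetric
            decreasing_on_support_tail_uniform[OF _ L] unit_uniform_tail_le_tail_sup dest: uniform_unimodal_symmetric)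
    show "tail_sup (\<lambda>\<mu>. unimodal_law \<mu> \<and> symmetric_law \<mu>) L \<le> tail_sup decreasing_law_on_support L"
      by (rule tail_sup_le_of_unit_uniform)
         (auto intro: return_decreasing_on_support tail_sup_nonneg unimodal_return return_symmetric
            unimodal_symmetric_tail_uniform[OF _ L] unit_uniform_tail_le_tail_sup uniform_decreasing_on_support)
  qed
qed

text \<open>The interval \<open>[L + 1 - w, L + 1]\<close> of length \<open>w = e\<^bsup>L+1\<^esup>\<close> has exponential moment below \<open>1\<close> and tail \<open>1 / w\<close>.\<close>
lemma tail_sup_decreasing_on_support_ge:
  assumes "0 \<le> L"
  shows "exp (- L) / exp 1 \<le> tail_sup decreasing_law_on_support L"
proof (rule unit_uniform_tail_le_tail_sup)
  define w where "w = exp (1 + L)"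
  have w1: "1 \<le> w" "0 < w" unfolding w_def using assms by auto
  have "exp (L + 1) - exp (L + 1 - w) \<le> w" by (simp add: w_def add.commute)
  then show "unit_uniform_tail L (exp (- L) / exp 1)"
    unfolding unit_uniform_tail_def using w1
    by (intro exI[of _ "L + 1 - w"] exI[of _ "L + 1"]) (auto simp: w_def exp_add exp_minus field_simps)
qed (rule uniform_decreasing_on_support)

text \<open>
  In terms of the length \<open>w = b - a\<close> the moment condition reads \<open>e\<^bsup>qw\<^esup> (1 - e\<^bsup>-w\<^esup>) \<le> w \<gamma>\<close>, with
  \<open>\<gamma> = e\<^bsup>-L\<^esup>\<close>. The first conclusion uses \<open>2 sinh (w/2) \<ge> w\<close>, the second \<open>e\<^bsup>qw\<^esup> \<ge> e q w\<close>.
\<close>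
lemma unit_uniform_tailE:
  assumes "unit_uniform_tail L q"
  obtains w where "0 < w" "0 \<le> q" "exp ((q - 1/2) * w) \<le> exp (- L)" "exp 1 * q * (1 - exp (- w)) \<le> exp (- L)"
proof -
  obtain a b where ab: "a < b" "a \<le> L" "L \<le> b" "exp b - exp a \<le> b - a" "q = (b - L) / (b - a)"
    using assms unfolding unit_uniform_tail_def by blast
  define w where "w = b - a"
  have w: "0 < w" using ab by (simp add: w_def)
  have q: "0 \<le> q" "q * w = b - L" using ab by (auto simp: w_def)
  have main: "exp (q * w) * (1 - exp (- w)) \<le> w * exp (- L)"
  proof -
    have "exp (q * w) * (1 - exp (- w)) = exp (- L) * (exp b - exp a)"
    proof -
      have "exp (b - L) * exp (- w) = exp (a - L)" "exp (- L) * exp b = exp (b - L)"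
        "exp (- L) * exp a = exp (a - L)" by (simp_all add: mult_exp_exp w_def)
      then show ?thesis unfolding q(2) by (simp add: right_diff_distrib)
    qed
    also have "\<dots> \<le> exp (- L) * w" using ab by (intro mult_left_mono) (auto simp: w_def)
    finally show ?thesis by (simp add: mult.commute)
  qed
  have "exp ((q - 1/2) * w) \<le> exp (- L)"
  proof -
    have "w \<le> exp (w / 2) - exp (- (w / 2))" using real_le_x_sinh[of "w / 2"] w
      by (simp only: exp_minus[symmetric]) simp
    then have "exp ((q - 1/2) * w) * w \<le> exp ((q - 1/2) * w) * (exp (w / 2) - exp (- (w / 2)))"
      by (intro mult_left_mono) auto
    also have "\<dots> = exp (q * w) * (1 - exp (- w))" by (simp add: algebra_simps mult_exp_exp)
    also have "\<dots> \<le> exp (- L) * w" using main by (simp add: mult.commute)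
    finally show ?thesis using w by simp
  qed
  moreover have "exp 1 * q * (1 - exp (- w)) \<le> exp (- L)"
  proof -
    have "exp 1 * (q * w) \<le> exp (q * w)"
    proof -
      have "1 + (q * w - 1) \<le> exp (q * w - 1)" by (rule exp_ge_add_one_self)
      then have "exp 1 * (q * w) \<le> exp 1 * exp (q * w - 1)" by (intro mult_left_mono) auto
      then show ?thesis by (simp add: mult_exp_exp)
    qed
    then have "exp 1 * (q * w) * (1 - exp (- w)) \<le> exp (q * w) * (1 - exp (- w))"
      using w by (intro mult_right_mono) auto
    also note main
    finally have "w * (exp 1 * q * (1 - exp (- w))) \<le> w * exp (- L)" by (simp add: mult_ac)
    then show ?thesis using w by simp
  qed
  ultimately show ?thesis using that w q(1) by blast
qed

text \<open>The first estimate implies \<open>\<gamma>\<^sup>2 \<ge> e\<^bsup>-w\<^esup>\<close>, and this removes \<open>w\<close> from the second one.\<close>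
lemma unit_uniform_tail_le_over_e:
  assumes "unit_uniform_tail L q" "0 < L"
  shows "q \<le> exp (- L) / (exp 1 * (1 - (exp (- L))\<^sup>2))"
proof -
  obtain w where w: "0 < w" "0 \<le> q" "exp ((q - 1/2) * w) \<le> exp (- L)" "exp 1 * q * (1 - exp (- w)) \<le> exp (- L)"
    using unit_uniform_tailE[OF assms(1)] by metis
  have "exp (- w) \<le> (exp (- L))\<^sup>2"
  proof -
    have "exp (- w / 2) \<le> exp ((q - 1/2) * w)" using w by (simp add: algebra_simps)
    then have "exp (- w / 2) \<le> exp (- L)" using w(3) by linarith
    then have "(exp (- w / 2))\<^sup>2 \<le> (exp (- L))\<^sup>2" by (intro power_mono) auto
    then show ?thesis by (simp add: exp_double[symmetric])
  qed
  then have "exp 1 * q * (1 - (exp (- L))\<^sup>2) \<le> exp 1 * q * (1 - exp (- w))"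
    using w by (intro mult_left_mono) auto
  then have "q * (exp 1 * (1 - (exp (- L))\<^sup>2)) \<le> exp (- L)" using w(4) by (simp add: mult_ac)
  moreover have "(exp (- L))\<^sup>2 < 1" using assms(2) by (simp add: exp_double[symmetric])
  ultimately show ?thesis by (simp add: pos_le_divide_eq)
qed

text \<open>The proof gives \<open>2 q \<le> \<gamma>\<close>: for \<open>w \<le> 2\<close> by linearising the first estimate, for \<open>w \<ge> 2\<close> by the second
  one and \<open>e (1 - e\<^bsup>-2\<^esup>) = 2 sinh 1 \<ge> 2\<close>.\<close>
lemma unit_uniform_tail_le_over_sqrt:
  assumes "unit_uniform_tail L q" "0 < L"
  shows "q \<le> exp (- L) / (1 + sqrt (1 - (exp (- L))\<^sup>2))"
proof -
  obtain w where w: "0 < w" "0 \<le> q" "exp ((q - 1/2) * w) \<le> exp (- L)" "exp 1 * q * (1 - exp (- w)) \<le> exp (- L)"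
    using unit_uniform_tailE[OF assms(1)] by metis
  define \<gamma> where "\<gamma> = exp (- L)"
  have \<gamma>: "0 < \<gamma>" "\<gamma> < 1" using assms(2) by (auto simp: \<gamma>_def)
  have "exp ((q - 1/2) * w) < 1" using w(3) \<gamma> by (simp add: \<gamma>_def)
  then have "(q - 1/2) * w < 0" by simp
  then have half: "q < 1 / 2" using w(1) by (simp add: mult_less_0_iff)
  have key: "2 * q \<le> \<gamma>"
  proof (cases "w \<le> 2")
    case True
    define P where "P = (1 / 2 - q) * w"
    have "P \<le> (1 / 2 - q) * 2" unfolding P_def using half True by (intro mult_left_mono) auto
    then have "2 * q \<le> 1 + - P" by simp
    also have "\<dots> \<le> exp (- P)" by (rule exp_ge_add_one_self)
    also have "- P = (q - 1/2) * w" by (simp add: P_def algebra_simps)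
    finally have "2 * q \<le> exp ((q - 1/2) * w)" .
    then show ?thesis using w(3) unfolding \<gamma>_def by (rule order_trans)
  next
    case False
    then have "exp (- w) \<le> exp (- 2)" by simp
    have e: "2 \<le> exp 1 * (1 - exp (- 2 :: real))"
    proof -
      have "exp 1 * (1 - exp (- 2)) = exp 1 - exp (- 1 :: real)" by (simp add: algebra_simps mult_exp_exp)
      moreover have "1 \<le> (exp 1 - exp (- 1 :: real)) / 2"
        using real_le_x_sinh[of 1] by (simp only: exp_minus[symmetric])
      ultimately show ?thesis by simp
    qed
    have "q * 2 \<le> q * (exp 1 * (1 - exp (- 2)))" using e w(2) by (intro mult_left_mono)
    also have "\<dots> = exp 1 * q * (1 - exp (- 2))" by simp
    also have "\<dots> \<le> exp 1 * q * (1 - exp (- w))" using \<open>exp (- w) \<le> exp (- 2)\<close> w(2) by (intro mult_left_mono) auto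
    also have "\<dots> \<le> \<gamma>" using w(4) by (simp add: \<gamma>_def)
    finally show ?thesis by (simp add: mult.commute)
  qed
  have s: "0 \<le> sqrt (1 - \<gamma>\<^sup>2)" "sqrt (1 - \<gamma>\<^sup>2) \<le> 1" using \<gamma> by (auto simp: power_le_one)
  then have "q * (1 + sqrt (1 - \<gamma>\<^sup>2)) \<le> q * 2" using w(2) by (intro mult_left_mono) auto
  then have "q * (1 + sqrt (1 - \<gamma>\<^sup>2)) \<le> \<gamma>" using key by linarith
  moreover have "0 < 1 + sqrt (1 - \<gamma>\<^sup>2)" using s by linarith
  ultimately show ?thesis by (simp add: pos_le_divide_eq \<gamma>_def)
qed

lemma tail_sup_unimodal_symmetric_le:
  assumes "0 < L"
  shows "tail_sup (\<lambda>\<mu>. unimodal_law \<mu> \<and> symmetric_law \<mu>) L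
    \<le> min (exp (- L) / (exp 1 * (1 - (exp (- L))\<^sup>2))) (exp (- L) / (1 + sqrt (1 - (exp (- L))\<^sup>2)))"
proof -
  have e: "(exp (- L))\<^sup>2 < 1" using assms by (simp add: exp_double[symmetric])
  show ?thesis
  proof (rule tail_sup_le_of_unit_uniform)
    show "0 \<le> min (exp (- L) / (exp 1 * (1 - (exp (- L))\<^sup>2))) (exp (- L) / (1 + sqrt (1 - (exp (- L))\<^sup>2)))"
      using e by (auto intro!: divide_nonneg_nonneg mult_nonneg_nonneg add_nonneg_nonneg)
  qed (use unimodal_return return_symmetric unit_uniform_tail_le_over_e[OF _ assms]
        unit_uniform_tail_le_over_sqrt[OF _ assms] unimodal_symmetric_tail_uniform[OF _ assms] in auto)
qed

section \<open>Normal log-laws\<close>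

text \<open>Completing the square: exponential tilting shifts the mean by the variance.\<close>
lemma exp_tilt_normal_density:
  assumes "0 < \<sigma>"
  shows "exp y * normal_density m \<sigma> y = exp (m + \<sigma>\<^sup>2 / 2) * normal_density (m + \<sigma>\<^sup>2) \<sigma> y"
proof -
  have "y + - (y - m)\<^sup>2 / (2 * \<sigma>\<^sup>2) = (m + \<sigma>\<^sup>2 / 2) + - (y - (m + \<sigma>\<^sup>2))\<^sup>2 / (2 * \<sigma>\<^sup>2)"
    using assms by (simp add: field_simps power2_eq_square)
  then have "exp y * exp (- (y - m)\<^sup>2 / (2 * \<sigma>\<^sup>2)) = exp (m + \<sigma>\<^sup>2 / 2) * exp (- (y - (m + \<sigma>\<^sup>2))\<^sup>2 / (2 * \<sigma>\<^sup>2))"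
    by (simp only: exp_add[symmetric])
  then show ?thesis unfolding normal_density_def by (simp add: mult.left_commute mult.assoc)
qed

lemma nn_integral_normal_density:
  assumes "0 < \<sigma>"
  shows "(\<integral>\<^sup>+ y. ennreal (normal_density m \<sigma> y) \<partial>lborel) = 1"
  using assms by (simp add: nn_integral_eq_integral)

lemma real_distribution_normal:
  assumes "0 < \<sigma>"
  shows "real_distribution (density lborel (\<lambda>y. ennreal (normal_density m \<sigma> y)))"
  using prob_space_normal_density[OF assms, of m]
  by (auto simp: real_distribution_def real_distribution_axioms_def)

lemma nn_integral_exp_normal:
  assumes "0 < \<sigma>"
  shows "(\<integral>\<^sup>+ y. ennreal (exp y) \<partial>density lborel (\<lambda>y. ennreal (normal_density m \<sigma> y))) = ennreal (exp (m + \<sigma>\<^sup>2 / 2))"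
proof -
  have "(\<integral>\<^sup>+ y. ennreal (exp y) \<partial>density lborel (\<lambda>y. ennreal (normal_density m \<sigma> y)))
      = (\<integral>\<^sup>+ y. ennreal (exp y * normal_density m \<sigma> y) \<partial>lborel)"
    by (subst nn_integral_density) (auto intro!: nn_integral_cong simp: ennreal_mult' mult.commute)
  also have "\<dots> = (\<integral>\<^sup>+ y. ennreal (exp (m + \<sigma>\<^sup>2 / 2)) * ennreal (normal_density (m + \<sigma>\<^sup>2) \<sigma> y) \<partial>lborel)"
    by (simp only: exp_tilt_normal_density[OF assms]) (simp add: ennreal_mult')
  also have "\<dots> = ennreal (exp (m + \<sigma>\<^sup>2 / 2))"
    by (simp add: nn_integral_cmult nn_integral_normal_density[OF assms])
  finally show ?thesis .
qed

lemma measure_normal_tail: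
  assumes "0 < \<sigma>"
  shows "measure (density lborel (\<lambda>y. ennreal (normal_density m \<sigma> y))) {L..}
    = cdf std_normal_distribution ((m - L) / \<sigma>)"
proof -
  have eq: "\<sigma> * normal_density m \<sigma> (m - \<sigma> * y) = std_normal_density y" for y
    using assms by (simp add: normal_density_def real_sqrt_mult power_mult_distrib)
  have "emeasure (density lborel (\<lambda>y. ennreal (normal_density m \<sigma> y))) {L..}
      = (\<integral>\<^sup>+ y. ennreal (normal_density m \<sigma> y) * indicator {L..} y \<partial>lborel)"
    by (subst emeasure_density) auto
  also have "\<dots> = ennreal \<bar>- \<sigma>\<bar> * (\<integral>\<^sup>+ y. ennreal (normal_density m \<sigma> (m + - \<sigma> * y)) * indicator {L..} (m + - \<sigma> * y) \<partial>lborel)"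
    using assms by (intro nn_integral_real_affine) auto
  also have "\<dots> = (\<integral>\<^sup>+ y. ennreal \<sigma> * (ennreal (normal_density m \<sigma> (m - \<sigma> * y)) * indicator {L..} (m - \<sigma> * y)) \<partial>lborel)"
    using assms by (subst nn_integral_cmult) auto
  also have "\<dots> = (\<integral>\<^sup>+ y. ennreal (std_normal_density y) * indicator {..(m - L) / \<sigma>} y \<partial>lborel)"
  proof (intro nn_integral_cong)
    fix y
    have "L \<le> m - \<sigma> * y \<longleftrightarrow> y \<le> (m - L) / \<sigma>" using assms by (simp add: field_simps)
    then show "ennreal \<sigma> * (ennreal (normal_density m \<sigma> (m - \<sigma> * y)) * indicator {L..} (m - \<sigma> * y))
      = ennreal (std_normal_density y) * indicator {..(m - L) / \<sigma>} y"
      using assms by (simp add: eq[symmetric] ennreal_mult' mult.assoc indicator_def)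
  qed
  also have "\<dots> = emeasure std_normal_distribution {..(m - L) / \<sigma>}"
    by (subst emeasure_density) auto
  finally show ?thesis by (simp add: measure_def cdf_def)
qed

text \<open>The tail is \<open>\<Phi> ((m - L) / \<sigma>)\<close>, and \<open>m \<le> - \<sigma>\<^sup>2 / 2\<close> leaves the maximisation of \<open>- (\<sigma> / 2 + L / \<sigma>)\<close>,
  which is at most \<open>- sqrt (2 L)\<close>, with equality for \<open>\<sigma>\<^sup>2 = 2 L\<close> and \<open>m = - L\<close>.\<close>
lemma tail_sup_normal:
  assumes L: "0 < L"
  shows "tail_sup normal_law L = cdf std_normal_distribution (- sqrt (2 * L))"
proof (rule antisym)
  interpret N: real_distribution std_normal_distribution by (rule real_dist_normal_dist)
  show "tail_sup normal_law L \<le> cdf std_normal_distribution (- sqrt (2 * L))"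
  proof (rule tail_sup_least)
    show "log_laws normal_law \<noteq> {}"
      using return_0_in_log_laws[of normal_law] by (auto simp: normal_law_def)
    fix \<mu> assume \<mu>: "\<mu> \<in> log_laws normal_law"
    then have int: "(\<integral>\<^sup>+ x. ennreal (exp x) \<partial>\<mu>) \<le> 1" by (simp add: log_laws_def)
    consider m where "\<mu> = return borel m" | m \<sigma> where "0 < \<sigma>" "\<mu> = density lborel (\<lambda>y. ennreal (normal_density m \<sigma> y))"
      using \<mu> unfolding log_laws_def normal_law_def by auto
    then show "measure \<mu> {L..} \<le> cdf std_normal_distribution (- sqrt (2 * L))"
    proof cases
      case (1 m)
      then have "m \<le> 0" using int by (simp add: nn_integral_return)
      then show ?thesis using 1 L by (simp add: measure_return N.cdf_nonneg)
    next
      case (2 m \<sigma>)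
      have "ennreal (exp (m + \<sigma>\<^sup>2 / 2)) \<le> ennreal 1" using int nn_integral_exp_normal[OF 2(1), of m] 2(2) by simp
      then have m: "m + \<sigma>\<^sup>2 / 2 \<le> 0" by (subst (asm) ennreal_le_iff) auto
      have sq: "(sqrt (2 * L))\<^sup>2 = 2 * L" using L by simp
      have "0 \<le> (\<sigma> - sqrt (2 * L))\<^sup>2" by simp
      then have "sqrt (2 * L) * \<sigma> \<le> \<sigma>\<^sup>2 / 2 + L" unfolding power2_diff sq by (simp add: algebra_simps)
      also have "\<dots> \<le> L - m" using m by simp
      finally have "(m - L) / \<sigma> \<le> - sqrt (2 * L)" using 2(1) by (simp add: pos_divide_le_eq)
      then show ?thesis unfolding 2(2) measure_normal_tail[OF 2(1)] by (rule N.cdf_nondecreasing)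
    qed
  qed
  define \<sigma> where "\<sigma> = sqrt (2 * L)"
  have \<sigma>: "0 < \<sigma>" "\<sigma>\<^sup>2 = 2 * L" using L by (auto simp: \<sigma>_def)
  let ?\<mu> = "density lborel (\<lambda>y. ennreal (normal_density (- L) \<sigma> y))"
  have "normal_law ?\<mu>" unfolding normal_law_def using \<sigma> by blast
  then have "?\<mu> \<in> log_laws normal_law"
    unfolding log_laws_def using real_distribution_normal[OF \<sigma>(1)] nn_integral_exp_normal[OF \<sigma>(1), of "- L"] \<sigma> by simp
  then have "measure ?\<mu> {L..} \<le> tail_sup normal_law L" by (rule tail_sup_upper)
  moreover have "(- L - L) / \<sigma> = - \<sigma>"
  proof -
    have "- L - L = - (\<sigma> * \<sigma>)" using \<sigma>(2) by (simp add: power2_eq_square)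
    then show ?thesis using \<sigma>(1) by simp
  qed
  ultimately show "cdf std_normal_distribution (- sqrt (2 * L)) \<le> tail_sup normal_law L"
    unfolding measure_normal_tail[OF \<sigma>(1)] \<sigma>_def[symmetric] by simp
qed

text \<open>On the tail the density is at most \<open>y / x\<close> times the density, which has an elementary antiderivative.\<close>
lemma normal_mills_ratio:
  assumes x: "0 < x"
  shows "cdf std_normal_distribution (- x) \<le> std_normal_density x / x"
proof -
  have dens: "std_normal_density y = exp (- y\<^sup>2 / 2) / sqrt (2 * pi)" for y
    by (simp add: std_normal_density_def)
  have "emeasure std_normal_distribution {..- x} = (\<integral>\<^sup>+ y. ennreal (std_normal_density y) * indicator {..- x} y \<partial>lborel)"
    by (subst emeasure_density) auto
  also have "\<dots> = (\<integral>\<^sup>+ y. ennreal (std_normal_density (0 + (-1) * y)) * indicator {..- x} (0 + (-1) * y) \<partial>lborel)"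
    by (subst nn_integral_real_affine[where c = "-1" and t = 0]) auto
  also have "\<dots> = (\<integral>\<^sup>+ y. ennreal (std_normal_density y) * indicator {x..} y \<partial>lborel)"
    by (intro nn_integral_cong) (auto split: split_indicator simp: dens)
  also have "\<dots> \<le> (\<integral>\<^sup>+ y. ennreal (y / x * std_normal_density y) * indicator {x..} y \<partial>lborel)"
  proof (intro nn_integral_mono)
    fix y
    have "1 * std_normal_density y \<le> y / x * std_normal_density y" if "x \<le> y"
      using that x by (intro mult_right_mono) auto
    then show "ennreal (std_normal_density y) * indicator {x..} y \<le> ennreal (y / x * std_normal_density y) * indicator {x..} y"
      by (auto split: split_indicator intro: ennreal_leI)
  qed
  also have "\<dots> = ennreal (0 - (- std_normal_density x / x))"
  proof (rule nn_integral_FTC_atLeast[where F = "\<lambda>y. - std_normal_density y / x"])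
    show "(\<lambda>y. y / x * std_normal_density y) \<in> borel_measurable borel" by measurable
    show "DERIV (\<lambda>y. - std_normal_density y / x) y :> y / x * std_normal_density y" for y
      unfolding dens using x by (auto intro!: derivative_eq_intros simp: field_simps)
    show "0 \<le> y / x * std_normal_density y" if "x \<le> y" for y using that x by auto
    have "((\<lambda>y. exp (- y\<^sup>2 / 2) :: real) \<longlongrightarrow> 0) at_top"
    proof (rule tendsto_sandwich)
      show "\<forall>\<^sub>F y::real in at_top. 0 \<le> exp (- y\<^sup>2 / 2)" by simp
      have sq: "y \<le> y\<^sup>2 / 2" if "2 \<le> y" for y :: real
        using mult_right_mono[OF that, of y] that by (simp add: power2_eq_square)
      show "\<forall>\<^sub>F y::real in at_top. exp (- y\<^sup>2 / 2) \<le> exp (- y)"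
        using eventually_ge_at_top[of "2::real"]
      proof eventually_elim
        case (elim y)
        then show ?case using sq[of y] by simp
      qed
      show "((\<lambda>y::real. exp (- y)) \<longlongrightarrow> 0) at_top"
        by (rule filterlim_compose[OF exp_at_bot filterlim_uminus_at_bot_at_top])
    qed simp
    then have "((\<lambda>y. - (exp (- y\<^sup>2 / 2) / sqrt (2 * pi)) / x) \<longlongrightarrow> - (0 / sqrt (2 * pi)) / x) at_top"
      by (intro tendsto_intros) (use x in auto)
    then show "((\<lambda>y. - std_normal_density y / x) \<longlongrightarrow> 0) at_top" by (simp add: dens)
  qed
  finally have "emeasure std_normal_distribution {..- x} \<le> ennreal (std_normal_density x / x)" by simp
  then show ?thesis unfolding cdf_def measure_def using x by (intro enn2real_leI) auto
qed

lemma normal_tail_at_sqrt_minus_2_ln: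
  assumes "0 < \<gamma>" "\<gamma> < 1"
  shows "cdf std_normal_distribution (- sqrt (- 2 * ln \<gamma>)) \<le> \<gamma> / (2 * sqrt (- pi * ln \<gamma>))"
proof -
  define x where "x = sqrt (- 2 * ln \<gamma>)"
  have l: "ln \<gamma> < 0" using assms by simp
  have x: "0 < x" "x\<^sup>2 = - 2 * ln \<gamma>" using l by (auto simp: x_def)
  have "std_normal_density x = \<gamma> / sqrt (2 * pi)"
    using assms by (simp add: std_normal_density_def x(2))
  then have "std_normal_density x / x = \<gamma> / (sqrt (2 * pi) * sqrt (- 2 * ln \<gamma>))" by (simp add: x_def)
  also have "sqrt (2 * pi) * sqrt (- 2 * ln \<gamma>) = sqrt (2\<^sup>2 * (- pi * ln \<gamma>))"
    by (simp add: real_sqrt_mult[symmetric])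
  also have "\<dots> = 2 * sqrt (- pi * ln \<gamma>)" by (simp only: real_sqrt_mult real_sqrt_abs)
  finally show ?thesis using normal_mills_ratio[OF x(1)] by (simp add: x_def)
qed

section \<open>From decreasing log-densities to decreasing densities\<close>

lemma emeasure_law_eq_log_law:
  assumes M: "prob_space M" and E: "E \<in> pos_e_variables M" and A: "A \<in> sets borel"
  shows "emeasure (law M E) A = emeasure (log_law M E) (exp -` A)"
proof -
  have [measurable]: "E \<in> borel_measurable M" using E by (auto simp: pos_e_variables_def e_variables_def)
  note A[measurable]
  have A': "exp -` A \<in> sets borel"
    using borel_measurable_exp A by (rule measurable_sets_borel)
  have "emeasure (log_law M E) (exp -` A) = emeasure M {\<omega>\<in>space M. exp (ln (enn2real (E \<omega>))) \<in> A}"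
    unfolding log_law_def using A' by (subst emeasure_distr) (auto intro!: arg_cong[where f = "emeasure M"])
  also have "\<dots> = emeasure M {\<omega>\<in>space M. enn2real (E \<omega>) \<in> A}"
  proof (rule emeasure_eq_AE)
    show "AE \<omega> in M. \<omega> \<in> {\<omega> \<in> space M. exp (ln (enn2real (E \<omega>))) \<in> A} \<longleftrightarrow> \<omega> \<in> {\<omega> \<in> space M. enn2real (E \<omega>) \<in> A}"
      using pos_e_variable_AE_exp_ln[OF M E] by (rule AE_mp) (auto intro!: AE_I2)
  qed measurable
  also have "\<dots> = emeasure (law M E) A"
    unfolding law_def by (subst emeasure_distr) (auto intro!: arg_cong[where f = "emeasure M"])
  finally show ?thesis ..
qed

text \<open>The substitution \<open>y = e\<^sup>x\<close> on bounded intervals, followed by monotone convergence.\<close>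
lemma nn_integral_exp_substitution:
  fixes F :: "real \<Rightarrow> ennreal"
  assumes F[measurable]: "F \<in> borel_measurable borel"
  shows "(\<integral>\<^sup>+ y. F y * indicator {1..} y \<partial>lborel) = (\<integral>\<^sup>+ x. F (exp x) * ennreal (exp x) * indicator {0..} x \<partial>lborel)"
proof -
  have "(\<integral>\<^sup>+ y. F y * indicator {1..} y \<partial>lborel) = (\<integral>\<^sup>+ y. (SUP n. F y * indicator {1..exp (real (Suc n))} y) \<partial>lborel)"
  proof (intro nn_integral_cong)
    fix y :: real
    have "\<exists>n. y \<le> exp (real (Suc n))"
    proof -
      obtain n where "y \<le> real n" using real_arch_simple by blast
      moreover have "real n \<le> exp (real (Suc n))" using exp_ge_add_one_self[of "real (Suc n)"] by simp
      ultimately show ?thesis by (intro exI[of _ n]) simp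
    qed
    then obtain n where n: "y \<le> exp (real (Suc n))" by blast
    show "F y * indicator {1..} y = (SUP n. F y * indicator {1..exp (real (Suc n))} y)"
    proof (rule antisym)
      show "F y * indicator {1..} y \<le> (SUP n. F y * indicator {1..exp (real (Suc n))} y)"
        using n by (intro SUP_upper2[of n]) (auto split: split_indicator)
      show "(SUP n. F y * indicator {1..exp (real (Suc n))} y) \<le> F y * indicator {1..} y"
        by (intro SUP_least) (auto split: split_indicator)
    qed
  qed
  also have "\<dots> = (SUP n. \<integral>\<^sup>+ y. F y * indicator {1..exp (real (Suc n))} y \<partial>lborel)"
  proof (rule nn_integral_monotone_convergence_SUP)
    show "incseq (\<lambda>n y. F y * indicator {1..exp (real (Suc n))} y)"
    proof (intro monoI le_funI mult_left_mono)
      fix i j :: nat and y :: real assume "i \<le> j"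
      then have "exp (real (Suc i)) \<le> exp (real (Suc j))" by simp
      then have "{1..exp (real (Suc i))} \<subseteq> {1..exp (real (Suc j))}" by (intro atLeastatMost_subset_iff[THEN iffD2]) blast
      then show "indicator {1..exp (real (Suc i))} y \<le> (indicator {1..exp (real (Suc j))} y :: ennreal)"
        by (auto simp: indicator_def of_bool_def simp del: atLeastatMost_subset_iff)
    qed simp
  qed measurable
  also have "\<dots> = (SUP n. \<integral>\<^sup>+ x. F (exp x) * ennreal (exp x) * indicator {0..real (Suc n)} x \<partial>lborel)"
  proof (intro SUP_cong refl)
    fix n
    have "(\<integral>\<^sup>+ y. F y * indicator {exp 0..exp (real (Suc n))} y \<partial>lborel)
        = (\<integral>\<^sup>+ x. F (exp x) * ennreal (exp x) * indicator {0..real (Suc n)} x \<partial>lborel)"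
      by (rule nn_integral_substitution_aux) (auto intro!: derivative_eq_intros continuous_intros)
    then show "(\<integral>\<^sup>+ y. F y * indicator {1..exp (real (Suc n))} y \<partial>lborel)
        = (\<integral>\<^sup>+ x. F (exp x) * ennreal (exp x) * indicator {0..real (Suc n)} x \<partial>lborel)" by simp
  qed
  also have "\<dots> = (\<integral>\<^sup>+ x. (SUP n. F (exp x) * ennreal (exp x) * indicator {0..real (Suc n)} x) \<partial>lborel)"
  proof (rule nn_integral_monotone_convergence_SUP[symmetric])
    show "incseq (\<lambda>n x. F (exp x) * ennreal (exp x) * indicator {0..real (Suc n)} x)"
      by (intro monoI le_funI mult_left_mono) (auto split: split_indicator)
  qed measurable
  also have "\<dots> = (\<integral>\<^sup>+ x. F (exp x) * ennreal (exp x) * indicator {0..} x \<partial>lborel)"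
  proof (intro nn_integral_cong)
    fix x :: real
    obtain n where n: "x \<le> real n" using real_arch_simple by blast
    show "(SUP n. F (exp x) * ennreal (exp x) * indicator {0..real (Suc n)} x) = F (exp x) * ennreal (exp x) * indicator {0..} x"
    proof (rule antisym)
      show "F (exp x) * ennreal (exp x) * indicator {0..} x \<le> (SUP n. F (exp x) * ennreal (exp x) * indicator {0..real (Suc n)} x)"
        using n by (intro SUP_upper2[of n]) (auto split: split_indicator)
      show "(SUP n. F (exp x) * ennreal (exp x) * indicator {0..real (Suc n)} x) \<le> F (exp x) * ennreal (exp x) * indicator {0..} x"
        by (intro SUP_least) (auto split: split_indicator)
    qed
  qed
  finally show ?thesis .
qed

text \<open>The density of \<open>E\<close> is \<open>f (ln y) / y\<close>, a product of nonnegative decreasing functions on \<open>(1, \<infinity>)\<close>;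
  an atom of \<open>log E\<close> at \<open>0\<close> becomes an atom of \<open>E\<close> at \<open>1\<close>.\<close>
lemma E_LD_pos_subset_E_D_gt1:
  assumes M: "prob_space M"
  shows "E_LD_pos M \<subseteq> E_D_gt1 M"
proof
  fix E assume "E \<in> E_LD_pos M"
  then have E: "E \<in> pos_e_variables M" and dec: "decreasing_law_from 0 (log_law M E)"
    by (auto simp: E_LD_pos_def)
  obtain p f where f: "atom_plus_density {0..} 0 p f (log_law M E)" "antimono_on {0<..} f"
    using dec unfolding decreasing_law_from_def by auto
  have fm[measurable]: "f \<in> borel_measurable borel" and f0: "\<And>y. 0 \<le> f y" and p: "0 \<le> p"
    using f(1) by (auto simp: atom_plus_density_def)
  define g where "g y = (if 1 \<le> y then f (ln y) / y else 0)" for y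
  have gm[measurable]: "g \<in> borel_measurable borel" unfolding g_def by measurable
  have "atom_plus_density {1..} 1 p g (law M E)"
    unfolding atom_plus_density_def
  proof (intro conjI allI ballI impI)
    show "0 \<le> p" "g \<in> borel_measurable borel" by fact+
    show "0 \<le> g y" for y using f0 by (simp add: g_def)
    fix A :: "real set" assume A[measurable]: "A \<in> sets borel" and A1: "A \<subseteq> {1..}"
    have A'[measurable]: "exp -` A \<in> sets borel"
      using borel_measurable_exp A by (rule measurable_sets_borel)
    have A0: "exp -` A \<subseteq> {0..}" using A1 by force
    have "emeasure (law M E) A = emeasure (log_law M E) (exp -` A)"
      using M E A by (rule emeasure_law_eq_log_law)
    also have "\<dots> = ennreal p * indicator (exp -` A) 0 + emeasure (density lborel (\<lambda>y. ennreal (f y))) (exp -` A)"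
      using f(1) A' A0 unfolding atom_plus_density_def by blast
    also have "indicator (exp -` A) (0::real) = (indicator A 1 :: ennreal)" by (simp add: indicator_def)
    also have "emeasure (density lborel (\<lambda>y. ennreal (f y))) (exp -` A) = emeasure (density lborel (\<lambda>y. ennreal (g y))) A"
    proof -
      have "emeasure (density lborel (\<lambda>y. ennreal (g y))) A = (\<integral>\<^sup>+ y. (ennreal (g y) * indicator A y) * indicator {1..} y \<partial>lborel)"
        using A1 by (subst emeasure_density) (auto intro!: nn_integral_cong split: split_indicator)
      also have "\<dots> = (\<integral>\<^sup>+ x. (ennreal (g (exp x)) * indicator A (exp x)) * ennreal (exp x) * indicator {0..} x \<partial>lborel)"
        by (rule nn_integral_exp_substitution) measurable
      also have "\<dots> = (\<integral>\<^sup>+ x. ennreal (f x) * indicator (exp -` A) x \<partial>lborel)"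
      proof (intro nn_integral_cong)
        fix x :: real
        have "ennreal (g (exp x)) * ennreal (exp x) = ennreal (f x)" if "0 \<le> x"
          using that f0 by (simp add: g_def ennreal_mult'[symmetric])
        moreover have "0 \<le> x" if "exp x \<in> A" using that A0 by auto
        ultimately show "(ennreal (g (exp x)) * indicator A (exp x)) * ennreal (exp x) * indicator {0..} x = ennreal (f x) * indicator (exp -` A) x"
          by (auto split: split_indicator)
      qed
      also have "\<dots> = emeasure (density lborel (\<lambda>y. ennreal (f y))) (exp -` A)"
        by (subst emeasure_density) auto
      finally show ?thesis ..
    qed
    finally show "emeasure (law M E) A = ennreal p * indicator A 1 + emeasure (density lborel (\<lambda>y. ennreal (g y))) A" .
  qed
  moreover have "antimono_on {1<..} g"
  proof (rule monotone_onI)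
    fix y z :: real assume yz: "y \<in> {1<..}" "z \<in> {1<..}" "y \<le> z"
    then have "f (ln z) \<le> f (ln y)" using f(2) by (auto intro!: monotone_onD[OF f(2), of "ln y" "ln z"])
    then have "f (ln z) / z \<le> f (ln y) / y" using yz f0 by (intro frac_le) auto
    then show "g z \<le> g y" using yz by (simp add: g_def)
  qed
  ultimately have "decreasing_law_from 1 (law M E)" unfolding decreasing_law_from_def by blast
  then show "E \<in> E_D_gt1 M" using E by (simp add: E_D_gt1_def pos_e_variables_def)
qed

section \<open>The suprema\<close>

theorem theorem3:
  fixes M :: "'a measure"
  assumes "prob_space M" and "atomless M"
  shows
    "(\<forall>\<gamma>\<in>{0<..1}. (\<gamma> \<noteq> 1 \<longrightarrow> R M \<gamma> (E_LS M) = min \<gamma> (1 / 2))) \<and> R M 1 (E_LS M) = 1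
     \<and>
     (\<forall>\<gamma>\<in>{0<..1}. R M \<gamma> (E_LU M) = \<gamma>)
     \<and>
     (E_LD_pos M \<subseteq> E_D_gt1 M \<and>
      (\<forall>\<gamma>\<in>{0<..1}.
         (\<exists>!t. is_t \<gamma> t) \<and>
         \<gamma> / (exp 1 - \<gamma>) \<le> R M \<gamma> (E_LD_pos M) \<and>
         R M \<gamma> (E_LD_pos M) = \<gamma> / t_sol \<gamma>) \<and>
      antimono_on {0<..1} t_sol \<and> (t_sol \<longlongrightarrow> exp 1) (at_right 0) \<and>
      mono_on {0<..1} (\<lambda>\<gamma>. R M \<gamma> (E_LD_pos M) / \<gamma>) \<and>
      ((\<lambda>\<gamma>. R M \<gamma> (E_LD_pos M) / \<gamma>) \<longlongrightarrow> 1 / exp 1) (at_right 0))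
     \<and>
     (\<forall>\<gamma>\<in>{0<..1}.
        \<gamma> / exp 1 \<le> R M \<gamma> (E_LD M) \<and>
        R M \<gamma> (E_LD M) = R M \<gamma> (E_LUS M) \<and>
        ereal (R M \<gamma> (E_LUS M)) \<le>
          min (if \<gamma> = 1 then \<infinity> else ereal (\<gamma> / (exp 1 * (1 - \<gamma>\<^sup>2))))
              (ereal (\<gamma> / (1 + sqrt (1 - \<gamma>\<^sup>2)))))
     \<and>
     (\<forall>\<gamma>\<in>{0<..1}. \<gamma> \<noteq> 1 \<longrightarrow>
        R M \<gamma> (E_LN M) = cdf std_normal_distribution (- sqrt (- 2 * ln \<gamma>)) \<and>
        cdf std_normal_distribution (- sqrt (- 2 * ln \<gamma>)) \<le> \<gamma> / (2 * sqrt (- pi * ln \<gamma>)))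
     \<and> R M 1 (E_LN M) = 1"
proof -
  have R: "R M \<gamma> {E \<in> pos_e_variables M. P (log_law M E)} = tail_sup P (- ln \<gamma>)" if "0 < \<gamma>" for P \<gamma>
    using R_eq_tail_sup[OF assms that] .
  have LS: "R M \<gamma> (E_LS M) = tail_sup symmetric_law (- ln \<gamma>)"
    and LU: "R M \<gamma> (E_LU M) = tail_sup unimodal_law (- ln \<gamma>)"
    and LDp: "R M \<gamma> (E_LD_pos M) = tail_sup (decreasing_law_from 0) (- ln \<gamma>)"
    and LD: "R M \<gamma> (E_LD M) = tail_sup decreasing_law_on_support (- ln \<gamma>)"
    and LUS: "R M \<gamma> (E_LUS M) = tail_sup (\<lambda>\<mu>. unimodal_law \<mu> \<and> symmetric_law \<mu>) (- ln \<gamma>)"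
    and LN: "R M \<gamma> (E_LN M) = tail_sup normal_law (- ln \<gamma>)" if "0 < \<gamma>" for \<gamma>
    unfolding E_LS_def E_LU_def E_LD_pos_def E_LD_def E_LUS_def E_LN_def by (rule R[OF that])+
  have normal_0: "normal_law (return borel 0)" unfolding normal_law_def by blast
  have LDp_t: "R M \<gamma> (E_LD_pos M) = \<gamma> / t_sol \<gamma>" if "\<gamma> \<in> {0<..1}" for \<gamma>
    using that tail_sup_decreasing_from_0[of "- ln \<gamma>" "t_sol \<gamma>"] is_t_t_sol[of \<gamma>] by (simp add: LDp)
  have ratio: "R M \<gamma> (E_LD_pos M) / \<gamma> = 1 / t_sol \<gamma>" if "\<gamma> \<in> {0<..1}" for \<gamma>
    using that by (simp add: LDp_t)
  have t_anti: "antimono_on {0<..1} t_sol"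
  proof (rule monotone_onI)
    fix \<gamma> \<delta> :: real assume "\<gamma> \<in> {0<..1}" "\<delta> \<in> {0<..1}" "\<gamma> \<le> \<delta>"
    then show "t_sol \<delta> \<le> t_sol \<gamma>" using is_t_antimono[of \<gamma> "t_sol \<gamma>" \<delta> "t_sol \<delta>"] is_t_t_sol by simp
  qed
  have near_0: "\<forall>\<^sub>F \<gamma> in at_right 0. \<gamma> \<in> {0<..(1::real)}"
    unfolding eventually_at_right_field by (intro exI[of _ 1]) auto
  have t_lim: "(t_sol \<longlongrightarrow> exp 1) (at_right 0)"
  proof (rule tendsto_sandwich)
    show "\<forall>\<^sub>F \<gamma> in at_right 0. exp (1 - \<gamma>) \<le> t_sol \<gamma>"
      using near_0 by eventually_elim (auto intro: is_t_ge_exp is_t_t_sol)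
    show "\<forall>\<^sub>F \<gamma> in at_right 0. t_sol \<gamma> \<le> exp 1"
      using near_0 by eventually_elim (use is_t_t_sol in \<open>force simp: is_t_def\<close>)
    have "((\<lambda>\<gamma>::real. exp (1 - \<gamma>)) \<longlongrightarrow> exp (1 - 0)) (at_right 0)" by (intro tendsto_intros)
    then show "((\<lambda>\<gamma>::real. exp (1 - \<gamma>)) \<longlongrightarrow> exp 1) (at_right 0)" by simp
  qed simp
  have "\<gamma> / exp 1 \<le> R M \<gamma> (E_LD M)" "R M \<gamma> (E_LD M) = R M \<gamma> (E_LUS M)"
        "ereal (R M \<gamma> (E_LUS M)) \<le>
          min (if \<gamma> = 1 then \<infinity> else ereal (\<gamma> / (exp 1 * (1 - \<gamma>\<^sup>2))))
              (ereal (\<gamma> / (1 + sqrt (1 - \<gamma>\<^sup>2))))" if \<gamma>: "\<gamma> \<in> {0<..1}" for \<gamma>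
  proof -
    show "\<gamma> / exp 1 \<le> R M \<gamma> (E_LD M)" using \<gamma> tail_sup_decreasing_on_support_ge[of "- ln \<gamma>"] by (simp add: LD)
    show "R M \<gamma> (E_LD M) = R M \<gamma> (E_LUS M)" using \<gamma> by (simp add: LD LUS tail_sup_decreasing_eq_unimodal_symmetric)
    show "ereal (R M \<gamma> (E_LUS M)) \<le>
          min (if \<gamma> = 1 then \<infinity> else ereal (\<gamma> / (exp 1 * (1 - \<gamma>\<^sup>2)))) (ereal (\<gamma> / (1 + sqrt (1 - \<gamma>\<^sup>2))))"
    proof (cases "\<gamma> = 1")
      case True
      then show ?thesis using tail_sup_0[of "\<lambda>\<mu>. unimodal_law \<mu> \<and> symmetric_law \<mu>"] unimodal_return return_symmetric
        by (simp add: LUS)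
    next
      case False
      then show ?thesis using \<gamma> tail_sup_unimodal_symmetric_le[of "- ln \<gamma>"] by (simp add: LUS)
    qed
  qed
  moreover have "R M \<gamma> (E_LS M) = min \<gamma> (1 / 2)" if "\<gamma> \<in> {0<..1}" "\<gamma> \<noteq> 1" for \<gamma>
    using that tail_sup_symmetric[of "- ln \<gamma>"] by (simp add: LS)
  moreover have "R M 1 (E_LS M) = 1" using tail_sup_0[of symmetric_law] return_symmetric by (simp add: LS)
  moreover have "R M \<gamma> (E_LU M) = \<gamma>" if "\<gamma> \<in> {0<..1}" for \<gamma>
    using that tail_sup_unimodal[of "- ln \<gamma>"] by (simp add: LU)
  moreover have "\<exists>!t. is_t \<gamma> t" "\<gamma> / (exp 1 - \<gamma>) \<le> R M \<gamma> (E_LD_pos M)" if "\<gamma> \<in> {0<..1}" for \<gamma>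
  proof -
    show "\<exists>!t. is_t \<gamma> t" using that t_exists_unique by auto
    have "1 \<le> t_sol \<gamma>" "t_sol \<gamma> \<le> exp 1 - \<gamma>"
      using that is_t_t_sol[of \<gamma>] is_t_le_exp_minus[of \<gamma> "t_sol \<gamma>"] by (auto simp: is_t_def)
    then show "\<gamma> / (exp 1 - \<gamma>) \<le> R M \<gamma> (E_LD_pos M)"
      unfolding LDp_t[OF that] using that by (intro divide_left_mono) auto
  qed
  moreover have "mono_on {0<..1} (\<lambda>\<gamma>. R M \<gamma> (E_LD_pos M) / \<gamma>)"
  proof (rule mono_onI)
    fix \<gamma> \<delta> :: real assume a: "\<gamma> \<in> {0<..1}" "\<delta> \<in> {0<..1}" "\<gamma> \<le> \<delta>"
    then have "1 \<le> t_sol \<delta>" "t_sol \<delta> \<le> t_sol \<gamma>"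
      using is_t_t_sol[of \<delta>] monotone_onD[OF t_anti, of \<gamma> \<delta>] by (auto simp: is_t_def)
    then show "R M \<gamma> (E_LD_pos M) / \<gamma> \<le> R M \<delta> (E_LD_pos M) / \<delta>"
      unfolding ratio[OF a(1)] ratio[OF a(2)] by (intro divide_left_mono) auto
  qed
  moreover have "((\<lambda>\<gamma>. R M \<gamma> (E_LD_pos M) / \<gamma>) \<longlongrightarrow> 1 / exp 1) (at_right 0)"
  proof (rule Lim_transform_eventually)
    show "((\<lambda>\<gamma>. 1 / t_sol \<gamma>) \<longlongrightarrow> 1 / exp 1) (at_right 0)"
      using t_lim by (intro tendsto_divide) auto
    show "\<forall>\<^sub>F \<gamma> in at_right 0. 1 / t_sol \<gamma> = R M \<gamma> (E_LD_pos M) / \<gamma>"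
      using near_0 by eventually_elim (simp add: ratio)
  qed
  moreover have "R M \<gamma> (E_LN M) = cdf std_normal_distribution (- sqrt (- 2 * ln \<gamma>))"
    "cdf std_normal_distribution (- sqrt (- 2 * ln \<gamma>)) \<le> \<gamma> / (2 * sqrt (- pi * ln \<gamma>))"
    if "\<gamma> \<in> {0<..1}" "\<gamma> \<noteq> 1" for \<gamma>
    using that tail_sup_normal[of "- ln \<gamma>"] normal_tail_at_sqrt_minus_2_ln[of \<gamma>] by (simp_all add: LN)
  moreover have "R M 1 (E_LN M) = 1" using tail_sup_0[of normal_law] normal_0 by (simp add: LN)
  moreover note E_LD_pos_subset_E_D_gt1[OF assms(1)] LDp_t t_anti t_lim
  ultimately show ?thesis by (intro conjI ballI impI)
qed

end
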